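(* Let $(G,K)$ be a compact symmetric pair with $G$ connected, compact and simple, whose restricted root system $(\mathfrak a,R_{\mathfrak g,\mathfrak k})$ is irreducible, with Weyl group $W$, and whose half sum of positive roots $\delta$ satisfies $\delta\in\Gamma_G^*$. Let $a>0$ be such that $\lambda:=a^2-(\delta,\delta)$ is a Casimir eigenvalue (i.e. $\lambda=\lambda_V$ for some $V\in\widehat G_K$). Let $\widetilde W:=\{\widetilde w\in O(\widetilde{\mathfrak a}) : w\in W\}$. Then $\widetilde W\subset O(\widetilde{\mathfrak a})_{S(a)}$.
   Context: $M=G/K$ is a compact connected symmetric space with metric $g$. The inner product $(\cdot,\cdot)=\langle\cdot,\cdot\rangle$ on $\mathfrak a$ is induced by $g$, $C$ is a fixed Weyl chamber, and $\delta$ is the half sum of positive roots. $\Gamma_G:=\{H\in\mathfrak a : \exp_G(2\pi H)=e\}$, with dual lattice $\Gamma_G^*$ regarded in $\mathfrak a$ via the inner product. $\widehat G_K$ is the set of (classes of) complex irreducible representations $V$ of $G$ with $\dim V^K>0$. These are in bijection with $C\cap\Gamma_G^*$ via highest restricted weight, $\mu\mapsto V^\mu$. The Casimir eigenvalue of $V^\mu$ is $\lambda_\mu=a_\mu^2-(\delta,\delta)$ with $a_\mu=(\mu+\delta,\mu+\delta)^{1/2}$. $\mathbb{S}_a(-\delta)$ is the sphere in $\mathfrak a$ of radius $a$ centered at $-\delta$, and $S(a):=\mathbb{S}_a(-\delta)\cap\Gamma_G^*$. $\widetilde{\mathfrak a}$ is the set $\mathfrak a$ with the Euclidean vector space structure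 having origin $-\delta$: for $H,H'\in\mathfrak a$ and $c\in\mathbb{R}$, $(H-\delta)\oplus(H'-\delta):=(H+H')-\delta$, $c\odot(H-\delta):=cH-\delta$, and $\langle\langle H-\delta,H'-\delta\rangle\rangle:=\langle H,H'\rangle$. Each $\varphi\in\mathrm{End}(\mathfrak a)$ induces $\widetilde\varphi:\widetilde{\mathfrak a}\to\widetilde{\mathfrak a}$, $\widetilde\varphi(H-\delta)=\varphi(H)-\delta$, and $O(\widetilde{\mathfrak a})=\{\widetilde\varphi : \varphi\in O(\mathfrak a)\}$. Finally, $O(\widetilde{\mathfrak a})_{S(a)}:=\{\widetilde\varphi\in O(\widetilde{\mathfrak a}) : \widetilde\varphi(S(a))\subset S(a)\}$. *)

theory Defs
  imports "HOL-Analysis.Analysis" "HOL-Algebra.Bij" "HOL-Algebra.Generated_Groups"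
begin

subsection \<open>Smooth maps and Lie groups\<close>

text \<open>Only meant for open domains \<open>S\<close>.\<close>

fun Ck_on :: "nat \<Rightarrow> ('a::euclidean_space \<Rightarrow> 'b::euclidean_space) \<Rightarrow> 'a set \<Rightarrow> bool" where
  "Ck_on 0 f S \<longleftrightarrow> continuous_on S f"
| "Ck_on (Suc k) f S \<longleftrightarrow>
     (\<forall>x\<in>S. f differentiable (at x)) \<and> (\<forall>v. Ck_on k (\<lambda>x. frechet_derivative f (at x) v) S)"

definition smooth_on :: "('a::euclidean_space \<Rightarrow> 'b::euclidean_space) \<Rightarrow> 'a set \<Rightarrow> bool" where
  "smooth_on f S \<longleftrightarrow> (\<forall>k. Ck_on k f S)"

text \<open>An atlas is a set of charts \<open>(U, \<phi>)\<close> with values in the model space \<open>'e\<close>.\<close>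

record ('g, 'e) lie_group = "'g monoid" +
  topo :: "'g topology"
  atlas :: "('g set \<times> ('g \<Rightarrow> 'e)) set"

definition smooth_atlas :: "'g topology \<Rightarrow> ('g set \<times> ('g \<Rightarrow> 'e::euclidean_space)) set \<Rightarrow> bool" where
  "smooth_atlas T A \<longleftrightarrow>
     (\<Union>(U, \<phi>)\<in>A. U) = topspace T \<and>
     (\<forall>(U, \<phi>)\<in>A. openin T U \<and> open (\<phi> ` U) \<and>
        homeomorphic_map (subtopology T U) (top_of_set (\<phi> ` U)) \<phi>) \<and>
     (\<forall>(U, \<phi>)\<in>A. \<forall>(V, \<psi>)\<in>A. smooth_on (\<psi> \<circ> inv_into U \<phi>) (\<phi> ` (U \<inter> V)))"

definition smooth_self_map ::
    "('g, 'e::euclidean_space) lie_group \<Rightarrow> ('g \<Rightarrow> 'g) \<Rightarrow> bool" where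
  "smooth_self_map G f \<longleftrightarrow>
     continuous_map (topo G) (topo G) f \<and>
     (\<forall>(U, \<phi>)\<in>atlas G. \<forall>(V, \<psi>)\<in>atlas G.
        smooth_on (\<psi> \<circ> f \<circ> inv_into U \<phi>) (\<phi> ` {x\<in>U. f x \<in> V}))"

definition smooth_mult :: "('g, 'e::euclidean_space) lie_group \<Rightarrow> bool" where
  "smooth_mult G \<longleftrightarrow>
     continuous_map (prod_topology (topo G) (topo G)) (topo G) (\<lambda>(x, y). x \<otimes>\<^bsub>G\<^esub> y) \<and>
     (\<forall>(U, \<phi>)\<in>atlas G. \<forall>(V, \<psi>)\<in>atlas G. \<forall>(W, \<zeta>)\<in>atlas G.
        smooth_on (\<lambda>(x, y). \<zeta> (inv_into U \<phi> x \<otimes>\<^bsub>G\<^esub> inv_into V \<psi> y))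
          {(\<phi> g, \<psi> h) | g h. g \<in> U \<and> h \<in> V \<and> g \<otimes>\<^bsub>G\<^esub> h \<in> W})"

definition is_lie_group :: "('g, 'e::euclidean_space) lie_group \<Rightarrow> bool" where
  "is_lie_group G \<longleftrightarrow>
     group G \<and> topspace (topo G) = carrier G \<and>
     Hausdorff_space (topo G) \<and> second_countable (topo G) \<and>
     smooth_atlas (topo G) (atlas G) \<and>
     smooth_mult G \<and> smooth_self_map G (\<lambda>x. inv\<^bsub>G\<^esub> x)"


subsection \<open>The Lie algebra\<close>

text \<open>
  The tangent space at the identity is identified with the model space \<open>'e\<close> by means of a
  chart around the identity, chosen once and for all. Thus the Lie algebra has the type \<open>'e\<close>
  as its underlying vector space; the canonical inner product of \<open>'e\<close> plays no role.
\<close>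

definition id_chart :: "('g, 'e) lie_group \<Rightarrow> 'g set \<times> ('g \<Rightarrow> 'e)" where
  "id_chart G = (SOME c. c \<in> atlas G \<and> \<one>\<^bsub>G\<^esub> \<in> fst c)"

definition to_coord :: "('g, 'e) lie_group \<Rightarrow> 'g \<Rightarrow> 'e" where
  "to_coord G = snd (id_chart G)"

definition of_coord :: "('g, 'e) lie_group \<Rightarrow> 'e \<Rightarrow> 'g" where
  "of_coord G = inv_into (fst (id_chart G)) (to_coord G)"

definition id_coord :: "('g, 'e) lie_group \<Rightarrow> 'e" where
  "id_coord G = to_coord G \<one>\<^bsub>G\<^esub>"

text \<open>The differential at the identity of a map \<open>f\<close> from \<open>G\<close> to \<open>G\<close> fixing the identity.\<close>

definition tangent_map ::
    "('g, 'e::euclidean_space) lie_group \<Rightarrow> ('g \<Rightarrow> 'g) \<Rightarrow> 'e \<Rightarrow> 'e" where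
  "tangent_map G f = frechet_derivative (to_coord G \<circ> f \<circ> of_coord G) (at (id_coord G))"

definition Ad :: "('g, 'e::euclidean_space) lie_group \<Rightarrow> 'g \<Rightarrow> 'e \<Rightarrow> 'e" where
  "Ad G g = tangent_map G (\<lambda>x. g \<otimes>\<^bsub>G\<^esub> x \<otimes>\<^bsub>G\<^esub> inv\<^bsub>G\<^esub> g)"

text \<open>\<open>[X, Y] = ad(X) Y\<close>, where \<open>ad\<close> is the differential of \<open>Ad\<close> at the identity.\<close>

definition bracket :: "('g, 'e::euclidean_space) lie_group \<Rightarrow> 'e \<Rightarrow> 'e \<Rightarrow> 'e" where
  "bracket G X Y = frechet_derivative (\<lambda>x. Ad G (of_coord G x) Y) (at (id_coord G)) X"

text \<open>\<open>\<gamma>\<close> is the one-parameter subgroup \<open>t \<mapsto> exp\<^sub>G(t X)\<close>.\<close>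

definition one_parameter_subgroup ::
    "('g, 'e::euclidean_space) lie_group \<Rightarrow> 'e \<Rightarrow> (real \<Rightarrow> 'g) \<Rightarrow> bool" where
  "one_parameter_subgroup G X \<gamma> \<longleftrightarrow>
     continuous_map euclideanreal (topo G) \<gamma> \<and>
     (\<forall>s t. \<gamma> (s + t) = \<gamma> s \<otimes>\<^bsub>G\<^esub> \<gamma> t) \<and>
     ((to_coord G \<circ> \<gamma>) has_vector_derivative X) (at 0)"

definition is_lie_exp :: "('g, 'e::euclidean_space) lie_group \<Rightarrow> 'e \<Rightarrow> 'g \<Rightarrow> bool" where
  "is_lie_exp G X g \<longleftrightarrow> (\<exists>\<gamma>. one_parameter_subgroup G X \<gamma> \<and> \<gamma> 1 = g)"

definition simple_lie_group :: "('g, 'e::euclidean_space) lie_group \<Rightarrow> bool" where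
  "simple_lie_group G \<longleftrightarrow>
     (\<exists>X Y. bracket G X Y \<noteq> 0) \<and>
     (\<forall>I. subspace I \<and> (\<forall>X. \<forall>Y\<in>I. bracket G X Y \<in> I) \<longrightarrow> I = {0} \<or> I = UNIV)"

definition Ad_invariant_inner_product ::
    "('g, 'e::euclidean_space) lie_group \<Rightarrow> ('e \<Rightarrow> 'e \<Rightarrow> real) \<Rightarrow> bool" where
  "Ad_invariant_inner_product G B \<longleftrightarrow>
     bilinear B \<and> (\<forall>X Y. B X Y = B Y X) \<and> (\<forall>X. X \<noteq> 0 \<longrightarrow> B X X > 0) \<and>
     (\<forall>g\<in>carrier G. \<forall>X Y. B (Ad G g X) (Ad G g Y) = B X Y)"


subsection \<open>Symmetric pairs and restricted roots\<close>

definition fixed_subgroup :: "('g, 'e) lie_group \<Rightarrow> ('g \<Rightarrow> 'g) \<Rightarrow> 'g set" where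
  "fixed_subgroup G \<sigma> = {g \<in> carrier G. \<sigma> g = g}"

definition symmetric_pair ::
    "('g, 'e::euclidean_space) lie_group \<Rightarrow> 'g set \<Rightarrow> ('g \<Rightarrow> 'g) \<Rightarrow> bool" where
  "symmetric_pair G K \<sigma> \<longleftrightarrow>
     smooth_self_map G \<sigma> \<and> \<sigma> \<in> hom G G \<and> (\<forall>g\<in>carrier G. \<sigma> (\<sigma> g) = g) \<and>
     subgroup K G \<and> closedin (topo G) K \<and>
     connected_component_of_set (subtopology (topo G) (fixed_subgroup G \<sigma>)) \<one>\<^bsub>G\<^esub> \<subseteq> K \<and>
     K \<subseteq> fixed_subgroup G \<sigma>"

definition p_space :: "('g, 'e::euclidean_space) lie_group \<Rightarrow> ('g \<Rightarrow> 'g) \<Rightarrow> 'e set" where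
  "p_space G \<sigma> = {X. tangent_map G \<sigma> X = - X}"

definition abelian_subspace :: "('g, 'e::euclidean_space) lie_group \<Rightarrow> 'e set \<Rightarrow> bool" where
  "abelian_subspace G S \<longleftrightarrow> subspace S \<and> (\<forall>X\<in>S. \<forall>Y\<in>S. bracket G X Y = 0)"

definition maximal_abelian_in ::
    "('g, 'e::euclidean_space) lie_group \<Rightarrow> 'e set \<Rightarrow> 'e set \<Rightarrow> bool" where
  "maximal_abelian_in G P S \<longleftrightarrow>
     abelian_subspace G S \<and> S \<subseteq> P \<and>
     (\<forall>S'. abelian_subspace G S' \<and> S \<subseteq> S' \<and> S' \<subseteq> P \<longrightarrow> S' = S)"

text \<open>
  A pair \<open>(X, Y)\<close> stands for \<open>X + iY\<close> in the complexified Lie algebra, so the conditions say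
  \<open>[H, X + iY] = i \<langle>\<alpha>, H\<rangle> (X + iY)\<close>. Roots are regarded as elements of \<open>\<aa>\<close> via \<open>B\<close>.
\<close>

definition root_space ::
    "('g, 'e::euclidean_space) lie_group \<Rightarrow> ('e \<Rightarrow> 'e \<Rightarrow> real) \<Rightarrow> 'e set \<Rightarrow> 'e \<Rightarrow> ('e \<times> 'e) set" where
  "root_space G B \<aa> \<alpha> =
     {(X, Y). \<forall>H\<in>\<aa>. bracket G H X = - (B \<alpha> H) *\<^sub>R Y \<and> bracket G H Y = B \<alpha> H *\<^sub>R X}"

definition restricted_roots ::
    "('g, 'e::euclidean_space) lie_group \<Rightarrow> ('e \<Rightarrow> 'e \<Rightarrow> real) \<Rightarrow> 'e set \<Rightarrow> 'e set" where
  "restricted_roots G B \<aa> = {\<alpha>\<in>\<aa>. \<alpha> \<noteq> 0 \<and> root_space G B \<aa> \<alpha> \<noteq> {0}}"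

text \<open>The complex dimension of the root space; \<open>dim\<close> is the real one.\<close>

definition multiplicity_of_root ::
    "('g, 'e::euclidean_space) lie_group \<Rightarrow> ('e \<Rightarrow> 'e \<Rightarrow> real) \<Rightarrow> 'e set \<Rightarrow> 'e \<Rightarrow> nat" where
  "multiplicity_of_root G B \<aa> \<alpha> = dim (root_space G B \<aa> \<alpha>) div 2"

definition irreducible_roots :: "('e \<Rightarrow> 'e \<Rightarrow> real) \<Rightarrow> 'e set \<Rightarrow> bool" where
  "irreducible_roots B R \<longleftrightarrow>
     R \<noteq> {} \<and>
     (\<forall>R1 R2. R = R1 \<union> R2 \<and> (\<forall>\<alpha>\<in>R1. \<forall>\<beta>\<in>R2. B \<alpha> \<beta> = 0) \<longrightarrow> R1 = {} \<or> R2 = {})"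

text \<open>Weyl chambers are taken to be closed.\<close>

definition weyl_chamber ::
    "('e::euclidean_space \<Rightarrow> 'e \<Rightarrow> real) \<Rightarrow> 'e set \<Rightarrow> 'e set \<Rightarrow> 'e set \<Rightarrow> bool" where
  "weyl_chamber B \<aa> R C \<longleftrightarrow>
     (\<exists>C0 \<in> components {H\<in>\<aa>. \<forall>\<alpha>\<in>R. B \<alpha> H \<noteq> 0}. C = closure C0)"

definition positive_roots :: "('e \<Rightarrow> 'e \<Rightarrow> real) \<Rightarrow> 'e set \<Rightarrow> 'e set \<Rightarrow> 'e set" where
  "positive_roots B R C = {\<alpha>\<in>R. \<forall>H\<in>C. B \<alpha> H \<ge> 0}"

text \<open>Positive restricted roots are counted with multiplicity.\<close>

definition half_sum_positive ::
    "('g, 'e::euclidean_space) lie_group \<Rightarrow> ('e \<Rightarrow> 'e \<Rightarrow> real) \<Rightarrow> 'e set \<Rightarrow> 'e set \<Rightarrow> 'e" where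
  "half_sum_positive G B \<aa> C =
     (1/2) *\<^sub>R (\<Sum>\<alpha>\<in>positive_roots B (restricted_roots G B \<aa>) C.
        real (multiplicity_of_root G B \<aa> \<alpha>) *\<^sub>R \<alpha>)"

text \<open>Endomorphisms of \<open>\<aa>\<close> are functions that are \<open>undefined\<close> outside \<open>\<aa>\<close>.\<close>

definition root_reflection ::
    "('e::real_vector \<Rightarrow> 'e \<Rightarrow> real) \<Rightarrow> 'e set \<Rightarrow> 'e \<Rightarrow> 'e \<Rightarrow> 'e" where
  "root_reflection B \<aa> \<alpha> = (\<lambda>H\<in>\<aa>. H - (2 * B \<alpha> H / B \<alpha> \<alpha>) *\<^sub>R \<alpha>)"

definition weyl_group ::
    "('e::real_vector \<Rightarrow> 'e \<Rightarrow> real) \<Rightarrow> 'e set \<Rightarrow> 'e set \<Rightarrow> ('e \<Rightarrow> 'e) set" where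
  "weyl_group B \<aa> R = generate (BijGroup \<aa>) (root_reflection B \<aa> ` R)"


subsection \<open>Lattices, spheres and the shifted space\<close>

definition unit_lattice :: "('g, 'e::euclidean_space) lie_group \<Rightarrow> 'e set \<Rightarrow> 'e set" where
  "unit_lattice G \<aa> = {H\<in>\<aa>. is_lie_exp G ((2 * pi) *\<^sub>R H) \<one>\<^bsub>G\<^esub>}"

definition dual_lattice :: "('e \<Rightarrow> 'e \<Rightarrow> real) \<Rightarrow> 'e set \<Rightarrow> 'e set \<Rightarrow> 'e set" where
  "dual_lattice B \<aa> \<Gamma> = {\<mu>\<in>\<aa>. \<forall>H\<in>\<Gamma>. B \<mu> H \<in> \<int>}"

definition shifted_sphere ::
    "('e::real_vector \<Rightarrow> 'e \<Rightarrow> real) \<Rightarrow> 'e set \<Rightarrow> 'e \<Rightarrow> real \<Rightarrow> 'e set" where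
  "shifted_sphere B \<aa> c r = {x\<in>\<aa>. sqrt (B (x - c) (x - c)) = r}"

definition orth_group ::
    "('e::real_vector \<Rightarrow> 'e \<Rightarrow> real) \<Rightarrow> 'e set \<Rightarrow> ('e \<Rightarrow> 'e) set" where
  "orth_group B \<aa> =
     {\<phi> \<in> \<aa> \<rightarrow>\<^sub>E \<aa>.
        (\<forall>x\<in>\<aa>. \<forall>y\<in>\<aa>. \<phi> (x + y) = \<phi> x + \<phi> y) \<and>
        (\<forall>c. \<forall>x\<in>\<aa>. \<phi> (c *\<^sub>R x) = c *\<^sub>R \<phi> x) \<and>
        (\<forall>x\<in>\<aa>. \<forall>y\<in>\<aa>. B (\<phi> x) (\<phi> y) = B x y)}"

text \<open>The map sending \<open>H - \<delta>\<close> to \<open>\<phi>(H) - \<delta>\<close>.\<close>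

definition tilde :: "'e::real_vector set \<Rightarrow> 'e \<Rightarrow> ('e \<Rightarrow> 'e) \<Rightarrow> 'e \<Rightarrow> 'e" where
  "tilde \<aa> \<delta> \<phi> = (\<lambda>x\<in>\<aa>. \<phi> (x + \<delta>) - \<delta>)"

definition orth_group_tilde ::
    "('e::real_vector \<Rightarrow> 'e \<Rightarrow> real) \<Rightarrow> 'e set \<Rightarrow> 'e \<Rightarrow> ('e \<Rightarrow> 'e) set" where
  "orth_group_tilde B \<aa> \<delta> = tilde \<aa> \<delta> ` orth_group B \<aa>"

definition orth_group_tilde_preserving ::
    "('e::real_vector \<Rightarrow> 'e \<Rightarrow> real) \<Rightarrow> 'e set \<Rightarrow> 'e \<Rightarrow> 'e set \<Rightarrow> ('e \<Rightarrow> 'e) set" where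
  "orth_group_tilde_preserving B \<aa> \<delta> S = {\<psi> \<in> orth_group_tilde B \<aa> \<delta>. \<psi> ` S \<subseteq> S}"


subsection \<open>Representations and the Casimir operator\<close>

definition representation ::
    "('g, 'e) lie_group \<Rightarrow> ('g \<Rightarrow> complex^'m^'m) \<Rightarrow> bool" where
  "representation G \<rho> \<longleftrightarrow>
     continuous_map (topo G) euclidean \<rho> \<and> \<rho> \<one>\<^bsub>G\<^esub> = mat 1 \<and>
     (\<forall>g\<in>carrier G. \<forall>h\<in>carrier G. \<rho> (g \<otimes>\<^bsub>G\<^esub> h) = \<rho> g ** \<rho> h)"

definition irreducible_representation ::
    "('g, 'e) lie_group \<Rightarrow> ('g \<Rightarrow> complex^'m^'m) \<Rightarrow> bool" where
  "irreducible_representation G \<rho> \<longleftrightarrow>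
     representation G \<rho> \<and>
     (\<forall>U. vec.subspace U \<and> (\<forall>g\<in>carrier G. \<forall>v\<in>U. \<rho> g *v v \<in> U) \<longrightarrow> U = {0} \<or> U = UNIV)"

definition spherical_irrep ::
    "('g, 'e) lie_group \<Rightarrow> 'g set \<Rightarrow> ('g \<Rightarrow> complex^'m^'m) \<Rightarrow> bool" where
  "spherical_irrep G K \<rho> \<longleftrightarrow>
     irreducible_representation G \<rho> \<and> vec.dim {v. \<forall>k\<in>K. \<rho> k *v v = v} > 0"

definition diff_rep ::
    "('g, 'e::euclidean_space) lie_group \<Rightarrow> ('g \<Rightarrow> complex^'m^'m) \<Rightarrow> 'e \<Rightarrow> complex^'m^'m" where
  "diff_rep G \<rho> X = frechet_derivative (\<rho> \<circ> of_coord G) (at (id_coord G)) X"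

text \<open>
  The Casimir operator of \<open>\<rho>\<close> is \<open>- \<Sum> d\<rho>(E\<^sub>i)\<^sup>2\<close> for a \<open>B\<close>-orthonormal basis \<open>(E\<^sub>i)\<close> of the Lie
  algebra; the sign makes its eigenvalues nonnegative.
\<close>

definition orthonormal_basis_wrt ::
    "('e::euclidean_space \<Rightarrow> 'e \<Rightarrow> real) \<Rightarrow> 'e set \<Rightarrow> bool" where
  "orthonormal_basis_wrt B E \<longleftrightarrow>
     finite E \<and> span E = UNIV \<and> (\<forall>X\<in>E. \<forall>Y\<in>E. B X Y = (if X = Y then 1 else 0))"

definition casimir_eigenvalue ::
    "('g, 'e::euclidean_space) lie_group \<Rightarrow> ('e \<Rightarrow> 'e \<Rightarrow> real) \<Rightarrow>
     ('g \<Rightarrow> complex^'m^'m) \<Rightarrow> real \<Rightarrow> bool" where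
  "casimir_eigenvalue G B \<rho> l \<longleftrightarrow>
     (\<exists>E. orthonormal_basis_wrt B E \<and>
        - (\<Sum>X\<in>E. diff_rep G \<rho> X ** diff_rep G \<rho> X) = mat (complex_of_real l))"

end

theory Submission
  imports Defs
begin

text \<open>
  The shift by \<open>\<delta> \<in> \<Gamma>'\<close> reduces the claim to the invariance of the dual lattice \<open>\<Gamma>'\<close>, hence of the
  unit lattice, under each root reflection \<open>s\<^sub>\<alpha>\<close>. Since \<open>exp\<^sub>G (2\<pi> Ad(g) H) = g exp\<^sub>G (2\<pi> H) g\<^sup>-\<^sup>1\<close>, it
  suffices to find \<open>g \<in> G\<close> such that \<open>Ad(g)\<close> restricts to \<open>s\<^sub>\<alpha>\<close> on \<open>\<aa>\<close>. Choose a root vector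
  \<open>X + iY\<close> with \<open>X \<in> \<kk>\<close> and \<open>Y \<in> \<pp>\<close>. Then \<open>[X, Y]\<close> centralizes \<open>\<aa>\<close>, so it lies in \<open>\<aa>\<close> and
  equals \<open>-|Y|\<^sup>2 \<alpha>\<close>; hence \<open>ad X\<close> kills \<open>\<alpha>\<^sup>\<bottom> \<inter> \<aa>\<close> and generates a rotation of the plane spanned by
  \<open>\<alpha>\<close> and \<open>Y\<close>, whose half turn is \<open>s\<^sub>\<alpha>\<close> on \<open>\<aa>\<close>. No exponential map is needed to realize this half
  turn in \<open>Ad(G)\<close>: it is a limit of \<open>n\<close>-fold products of small steps \<open>Ad(g\<^sub>n)\<close>, and \<open>Ad(G)\<close> is compact.
\<close>

subsection \<open>Derivatives and charts\<close>

lemma has_derivative_eventually_eq: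
  assumes "(f has_derivative f') (at x)" "eventually (\<lambda>y. f y = g y) (nhds x)"
  shows "(g has_derivative f') (at x)"
  using assms(1)
proof (rule has_derivative_transform_eventually)
  show "eventually (\<lambda>y. f y = g y) (at x)"
    using assms(2) by (auto simp: eventually_at_filter elim: eventually_mono)
  show "f x = g x"
    using assms(2) by (rule eventually_nhds_x_imp_x)
qed simp

lemma differentiable_eventually_eq:
  assumes "f differentiable at x" "eventually (\<lambda>y. f y = g y) (nhds x)"
  shows "g differentiable at x"
proof -
  from assms(1) obtain D where "(f has_derivative D) (at x)" unfolding differentiable_def ..
  from has_derivative_eventually_eq[OF this assms(2)] show ?thesis
    unfolding differentiable_def by blast
qed

lemma linear_Basis_expansion:
  fixes f :: "'a::euclidean_space \<Rightarrow> 'b::real_vector"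
  assumes "linear f"
  shows "f v = (\<Sum>b\<in>Basis. (v \<bullet> b) *\<^sub>R f b)"
proof -
  have "f v = f (\<Sum>b\<in>Basis. (v \<bullet> b) *\<^sub>R b)" by (simp only: euclidean_representation)
  also have "\<dots> = (\<Sum>b\<in>Basis. (v \<bullet> b) *\<^sub>R f b)"
    by (simp add: linear_sum[OF assms] linear_scale[OF assms])
  finally show ?thesis .
qed

text \<open>\<open>Ck_on\<close> controls derivatives only in fixed directions, whereas here the
  direction \<open>u q\<close> moves with the point. Expanding \<open>u q\<close> in the basis
  reduces this to fixed directions; differentiability of \<open>m\<close> near \<open>f p\<close>
  makes the derivative linear there, so that the expansion is valid in a neighbourhood.\<close>

lemma differentiable_frechet_apply:
  fixes m :: "'x::euclidean_space \<Rightarrow> 'y::euclidean_space"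
  assumes f: "f differentiable at p" and u: "u differentiable at p"
    and lin: "eventually (\<lambda>q. m differentiable at (f q)) (nhds p)"
    and m: "\<And>v. (\<lambda>q. frechet_derivative m (at q) v) differentiable at (f p)"
  shows "(\<lambda>q. frechet_derivative m (at (f q)) (u q)) differentiable at p"
proof -
  have "(\<lambda>q. \<Sum>b\<in>Basis. (u q \<bullet> b) *\<^sub>R frechet_derivative m (at (f q)) b) differentiable at p"
  proof (intro differentiable_sum ballI differentiable_scaleR)
    fix b :: 'x assume "b \<in> Basis"
    show "(\<lambda>q. u q \<bullet> b) differentiable at p"
      using u by (intro differentiable_inner) auto
    show "(\<lambda>q. frechet_derivative m (at (f q)) b) differentiable at p"
      using differentiable_chain_at[OF f m[of b]] by (simp add: o_def)
  qed auto
  moreover have "eventually (\<lambda>q. (\<Sum>b\<in>Basis. (u q \<bullet> b) *\<^sub>R frechet_derivative m (at (f q)) b)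
      = frechet_derivative m (at (f q)) (u q)) (nhds p)"
    using lin by eventually_elim (metis linear_Basis_expansion linear_frechet_derivative)
  ultimately show ?thesis
    by (rule differentiable_eventually_eq)
qed

section \<open>Charts of a Lie group and differentiability of its operations\<close>

locale lie_grp = group G for G :: "('g, 'e::euclidean_space) lie_group" (structure) +
  assumes lie: "is_lie_group G"
begin

abbreviation "U0 \<equiv> fst (id_chart G)"
abbreviation "crd \<equiv> to_coord G"
abbreviation "pt \<equiv> of_coord G"
abbreviation "e0 \<equiv> id_coord G"

lemma topspace_topo [simp]: "topspace (topo G) = carrier G"
  using lie by (simp add: is_lie_group_def)

lemma smooth_atlas: "smooth_atlas (topo G) (atlas G)"
  using lie by (simp add: is_lie_group_def)

lemma smooth_mult: "smooth_mult G"
  using lie by (simp add: is_lie_group_def)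

lemma atlas_covers: "g \<in> carrier G \<Longrightarrow> \<exists>V \<psi>. (V, \<psi>) \<in> atlas G \<and> g \<in> V"
proof -
  assume "g \<in> carrier G"
  moreover have "(\<Union>(U, \<phi>)\<in>atlas G. U) = carrier G"
    using smooth_atlas unfolding smooth_atlas_def topspace_topo by (elim conjE)
  ultimately have "g \<in> (\<Union>(U, \<phi>)\<in>atlas G. U)" by simp
  then show ?thesis by auto
qed

lemma chart_properties:
  assumes "(V, \<psi>) \<in> atlas G"
  shows chart_openin: "openin (topo G) V"
    and chart_open_image: "open (\<psi> ` V)"
    and chart_homeo: "homeomorphic_map (subtopology (topo G) V) (top_of_set (\<psi> ` V)) \<psi>"
proof -
  have "\<forall>(U, \<phi>)\<in>atlas G. openin (topo G) U \<and> open (\<phi> ` U) \<and>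
        homeomorphic_map (subtopology (topo G) U) (top_of_set (\<phi> ` U)) \<phi>"
    using smooth_atlas unfolding smooth_atlas_def by (elim conjE)
  with assms show "openin (topo G) V" "open (\<psi> ` V)"
    "homeomorphic_map (subtopology (topo G) V) (top_of_set (\<psi> ` V)) \<psi>" by auto
qed

lemma chart_subset: "(V, \<psi>) \<in> atlas G \<Longrightarrow> V \<subseteq> carrier G"
  using chart_openin openin_subset by fastforce

lemma chart_inj:
  assumes "(V, \<psi>) \<in> atlas G" shows "inj_on \<psi> V"
proof -
  have "topspace (subtopology (topo G) V) = V"
    using chart_subset[OF assms] by auto
  then show ?thesis
    using chart_homeo[OF assms] homeomorphic_imp_injective_map by fastforce
qed

lemma chart_inv_continuous:
  assumes c: "(V, \<psi>) \<in> atlas G"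
  shows "continuous_map (top_of_set (\<psi> ` V)) (topo G) (inv_into V \<psi>)"
proof -
  have V: "topspace (subtopology (topo G) V) = V"
    using chart_subset[OF c] by auto
  obtain f' where f': "homeomorphic_maps (subtopology (topo G) V) (top_of_set (\<psi> ` V)) \<psi> f'"
    using chart_homeo[OF c] homeomorphic_map_maps by blast
  then have eq: "f' x = inv_into V \<psi> x" if "x \<in> \<psi> ` V" for x
    using that chart_inj[OF c] V unfolding homeomorphic_maps_def by auto
  have "continuous_map (top_of_set (\<psi> ` V)) (topo G) f'"
    using f' by (auto simp: homeomorphic_maps_def continuous_map_in_subtopology)
  then show ?thesis
    by (rule continuous_map_eq) (use eq in auto)
qed

lemma chart_continuous:
  assumes c: "(V, \<psi>) \<in> atlas G"
  shows "continuous_map (subtopology (topo G) V) euclidean \<psi>"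
  using chart_homeo[OF c] homeomorphic_imp_continuous_map continuous_map_in_subtopology by blast

lemma mult_continuous:
  "continuous_map (prod_topology (topo G) (topo G)) (topo G) (\<lambda>(x, y). x \<otimes> y)"
  using lie by (simp add: is_lie_group_def smooth_mult_def)

lemma continuous_map_mult:
  assumes "continuous_map T (topo G) f" "continuous_map T (topo G) h"
  shows "continuous_map T (topo G) (\<lambda>x. f x \<otimes> h x)"
proof -
  have "continuous_map T (prod_topology (topo G) (topo G)) (\<lambda>x. (f x, h x))"
    using assms by (simp add: continuous_map_paired)
  from continuous_map_compose[OF this mult_continuous] show ?thesis
    by (simp add: o_def)
qed

lemma inv_continuous: "continuous_map (topo G) (topo G) (\<lambda>x. inv x)"
  using lie by (simp add: is_lie_group_def smooth_self_map_def)

lemma continuous_map_inv: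
  assumes "continuous_map T (topo G) f"
  shows "continuous_map T (topo G) (\<lambda>x. inv (f x))"
  using continuous_map_compose[OF assms inv_continuous] by (simp add: o_def)

lemma id_chart_in: "(U0, crd) \<in> atlas G" and one_in_U0: "\<one> \<in> U0"
proof -
  have "\<exists>c. c \<in> atlas G \<and> \<one> \<in> fst c"
    using atlas_covers[OF one_closed] by force
  from someI_ex[OF this] show "(U0, crd) \<in> atlas G" "\<one> \<in> U0"
    unfolding id_chart_def to_coord_def by auto
qed

abbreviation "O0 \<equiv> crd ` U0"

lemma open_O0: "open O0"
  using chart_open_image[OF id_chart_in] .

lemma pt_crd [simp]: "g \<in> U0 \<Longrightarrow> pt (crd g) = g"
  unfolding of_coord_def using chart_inj[OF id_chart_in] by simp

lemma pt_in [simp]: "x \<in> O0 \<Longrightarrow> pt x \<in> U0"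
  unfolding of_coord_def by (rule inv_into_into)

lemma crd_pt [simp]: "x \<in> O0 \<Longrightarrow> crd (pt x) = x"
  unfolding of_coord_def by (rule f_inv_into_f)

lemma pt_carrier [simp]: "x \<in> O0 \<Longrightarrow> pt x \<in> carrier G"
  using pt_in chart_subset[OF id_chart_in] by blast

lemma e0_in [simp]: "e0 \<in> O0"
  using one_in_U0 by (simp add: id_coord_def)

lemma pt_e0 [simp]: "pt e0 = \<one>"
  using one_in_U0 by (simp add: id_coord_def)

lemma crd_one [simp]: "crd \<one> = e0"
  by (simp add: id_coord_def)

lemma pt_continuous: "continuous_map (top_of_set O0) (topo G) pt"
  using chart_inv_continuous[OF id_chart_in] unfolding of_coord_def .

lemma continuous_map_pt_comp:
  assumes "continuous_on S f" "f ` S \<subseteq> O0"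
  shows "continuous_map (top_of_set S) (topo G) (\<lambda>x. pt (f x))"
proof -
  have "continuous_map (top_of_set S) (top_of_set O0) f"
    using assms by (simp add: continuous_map_in_subtopology image_subset_iff)
  from continuous_map_compose[OF this pt_continuous] show ?thesis by (simp add: o_def)
qed

lemma open_preimage:
  assumes "continuous_map (top_of_set S) (topo G) f" "open S" "openin (topo G) V"
  shows "open {x \<in> S. f x \<in> V}"
proof -
  have "openin (top_of_set S) {x \<in> topspace (top_of_set S). f x \<in> V}"
    using assms by (intro openin_continuous_map_preimage) auto
  then show ?thesis using assms(2) by (simp add: openin_open_eq)
qed

lemma open_chart_preimage:
  assumes "continuous_map (top_of_set S) (topo G) f" "open S" "(V, \<psi>) \<in> atlas G"
  shows "open {x \<in> S. f x \<in> V}"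
  using open_preimage chart_openin assms by blast

lemma eventually_pt:
  assumes f: "continuous_map (topo G) (topo G) f" and V: "openin (topo G) V" "f \<one> \<in> V"
  shows "eventually (\<lambda>x. x \<in> O0 \<and> f (pt x) \<in> V) (nhds e0)"
proof -
  have "open {x \<in> O0. (f \<circ> pt) x \<in> V}"
    using continuous_map_compose[OF pt_continuous f] open_O0 V(1) by (rule open_preimage)
  then show ?thesis
    unfolding eventually_nhds using V(2) by (intro exI[of _ "{x \<in> O0. (f \<circ> pt) x \<in> V}"]) auto
qed

lemma smooth_multD:
  assumes "(U, \<phi>) \<in> atlas G" "(V, \<psi>) \<in> atlas G" "(W, \<zeta>) \<in> atlas G"
  shows "smooth_on (\<lambda>(x, y). \<zeta> (inv_into U \<phi> x \<otimes> inv_into V \<psi> y))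
          {(\<phi> g, \<psi> h) | g h. g \<in> U \<and> h \<in> V \<and> g \<otimes> h \<in> W}"
proof -
  have "\<forall>(U, \<phi>)\<in>atlas G. \<forall>(V, \<psi>)\<in>atlas G. \<forall>(W, \<zeta>)\<in>atlas G.
        smooth_on (\<lambda>(x, y). \<zeta> (inv_into U \<phi> x \<otimes> inv_into V \<psi> y))
          {(\<phi> g, \<psi> h) | g h. g \<in> U \<and> h \<in> V \<and> g \<otimes> h \<in> W}"
    using smooth_mult unfolding smooth_mult_def by (elim conjE)
  from this[THEN bspec, OF assms(1), unfolded prod.case, THEN bspec, OF assms(2), unfolded prod.case,
      THEN bspec, OF assms(3), unfolded prod.case]
  show ?thesis .
qed

lemma mult_differentiable:
  assumes "(U, \<phi>) \<in> atlas G" "(V, \<psi>) \<in> atlas G" "(W, \<zeta>) \<in> atlas G"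
    and "g \<in> U" "h \<in> V" "g \<otimes> h \<in> W"
  shows "(\<lambda>(x, y). \<zeta> (inv_into U \<phi> x \<otimes> inv_into V \<psi> y)) differentiable at (\<phi> g, \<psi> h)"
proof -
  have "Ck_on (Suc 0) (\<lambda>(x, y). \<zeta> (inv_into U \<phi> x \<otimes> inv_into V \<psi> y))
          {(\<phi> g, \<psi> h) | g h. g \<in> U \<and> h \<in> V \<and> g \<otimes> h \<in> W}"
    using smooth_multD[OF assms(1-3)] unfolding smooth_on_def by blast
  then show ?thesis using assms(4-6) by auto
qed

text \<open>The group law read in the identity chart on both factors; it is meaningful on
  \<open>mul_dom\<close>.\<close>

definition mul_c :: "'e \<times> 'e \<Rightarrow> 'e" where
  "mul_c = (\<lambda>(x, y). crd (pt x \<otimes> pt y))"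

definition mul_dom :: "('e \<times> 'e) set" where
  "mul_dom = {(x, y). x \<in> O0 \<and> y \<in> O0 \<and> pt x \<otimes> pt y \<in> U0}"

lemma mul_c_smooth: "smooth_on mul_c mul_dom"
proof -
  have "{(crd g, crd h) | g h. g \<in> U0 \<and> h \<in> U0 \<and> g \<otimes> h \<in> U0} = mul_dom"
    unfolding mul_dom_def by force
  then show ?thesis
    using smooth_multD[OF id_chart_in id_chart_in id_chart_in]
    unfolding mul_c_def of_coord_def by simp
qed

lemma mul_c_differentiable: "p \<in> mul_dom \<Longrightarrow> mul_c differentiable at p"
proof -
  have "Ck_on (Suc 0) mul_c mul_dom"
    using mul_c_smooth unfolding smooth_on_def by blast
  then show "p \<in> mul_dom \<Longrightarrow> mul_c differentiable at p" by auto
qed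

text \<open>This is smoothness of order two. It enters through \<open>D_conj\<close>, whose
  derivative at the identity yields the bracket.\<close>

lemma D_mul_c_differentiable:
  "p \<in> mul_dom \<Longrightarrow> (\<lambda>q. frechet_derivative mul_c (at q) v) differentiable at p"
proof -
  have "Ck_on (Suc (Suc 0)) mul_c mul_dom"
    using mul_c_smooth unfolding smooth_on_def by blast
  then show "p \<in> mul_dom \<Longrightarrow> (\<lambda>q. frechet_derivative mul_c (at q) v) differentiable at p"
    unfolding Ck_on.simps by blast
qed

definition inv_c :: "'e \<Rightarrow> 'e" where
  "inv_c x = crd (inv (pt x))"

lemma smooth_self_map_differentiable:
  assumes "smooth_self_map G f" "(U, \<phi>) \<in> atlas G" "(V, \<psi>) \<in> atlas G" "x \<in> U" "f x \<in> V"
  shows "(\<psi> \<circ> f \<circ> inv_into U \<phi>) differentiable at (\<phi> x)"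
proof -
  have "smooth_on (\<psi> \<circ> f \<circ> inv_into U \<phi>) (\<phi> ` {x\<in>U. f x \<in> V})"
  proof -
    have "\<forall>(U, \<phi>)\<in>atlas G. \<forall>(V, \<psi>)\<in>atlas G.
        smooth_on (\<psi> \<circ> f \<circ> inv_into U \<phi>) (\<phi> ` {x\<in>U. f x \<in> V})"
      using assms(1) unfolding smooth_self_map_def by (elim conjE)
    from this[THEN bspec, OF assms(2), unfolded prod.case, THEN bspec, OF assms(3), unfolded prod.case]
    show ?thesis .
  qed
  then have "Ck_on (Suc 0) (\<psi> \<circ> f \<circ> inv_into U \<phi>) (\<phi> ` {x\<in>U. f x \<in> V})"
    unfolding smooth_on_def by blast
  then show ?thesis using assms(4,5) by auto
qed

lemma inv_c_differentiable:
  assumes "x \<in> O0" "inv (pt x) \<in> U0"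
  shows "inv_c differentiable at x"
proof -
  have "smooth_self_map G (\<lambda>x. inv x)"
    using lie by (simp add: is_lie_group_def)
  from smooth_self_map_differentiable[OF this id_chart_in id_chart_in, of "pt x"] assms
  have "(crd \<circ> (\<lambda>x. inv x) \<circ> pt) differentiable at x"
    by (simp add: of_coord_def[symmetric])
  then show ?thesis by (simp add: inv_c_def[abs_def] o_def)
qed

section \<open>Conjugation in the identity chart\<close>

definition conj_c :: "'e \<times> 'e \<Rightarrow> 'e" where
  "conj_c = (\<lambda>(x, y). crd (pt x \<otimes> pt y \<otimes> inv (pt x)))"

text \<open>Besides the result, the product \<open>x y\<close> and the inverse of \<open>x\<close>
  are required to stay in the chart, so that conjugation factors as
  \<open>mul_c (mul_c p, inv_c (fst p))\<close>.\<close>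

definition conj_dom :: "('e \<times> 'e) set" where
  "conj_dom = {p \<in> O0 \<times> O0. pt (fst p) \<otimes> pt (snd p) \<in> U0} \<inter> {p \<in> O0 \<times> O0. inv (pt (fst p)) \<in> U0}
     \<inter> {p \<in> O0 \<times> O0. pt (fst p) \<otimes> pt (snd p) \<otimes> inv (pt (fst p)) \<in> U0}"

lemma open_conj_dom: "open conj_dom"
proof -
  have [intro]: "continuous_map (top_of_set (O0 \<times> O0)) (topo G) (\<lambda>p. pt (fst p))"
    "continuous_map (top_of_set (O0 \<times> O0)) (topo G) (\<lambda>p. pt (snd p))"
    by (auto intro!: continuous_map_pt_comp continuous_intros)
  show ?thesis
    unfolding conj_dom_def
    by (intro open_Int open_chart_preimage[OF _ _ id_chart_in] continuous_map_mult
        continuous_map_inv open_Times open_O0) auto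
qed

lemma conj_c_eq:
  assumes "p \<in> conj_dom"
  shows "conj_c p = mul_c (mul_c p, inv_c (fst p))" "p \<in> mul_dom" "(mul_c p, inv_c (fst p)) \<in> mul_dom"
  using assms by (auto simp: conj_c_def mul_c_def inv_c_def mul_dom_def conj_dom_def)

lemma conj_dom_e0:
  "x \<in> O0 \<Longrightarrow> inv (pt x) \<in> U0 \<Longrightarrow> (x, e0) \<in> conj_dom"
  "x \<in> O0 \<Longrightarrow> (e0, x) \<in> conj_dom"
  using one_in_U0 by (auto simp: conj_dom_def)

text \<open>The partial derivative of \<open>conj_c\<close> in its second argument, in direction
  \<open>Y\<close>, written out by the chain rule. The last entry is 0 because
  \<open>inv_c (fst p)\<close> does not depend on the second argument. In this form its
  differentiability in \<open>p\<close> can be read off from that of \<open>mul_c\<close> and its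
  derivatives.\<close>

definition D_conj :: "'e \<Rightarrow> 'e \<times> 'e \<Rightarrow> 'e" where
  "D_conj Y p = frechet_derivative mul_c (at (mul_c p, inv_c (fst p)))
     (frechet_derivative mul_c (at p) (0, Y), 0)"

lemma conj_c_derivative_snd:
  assumes "(x, y) \<in> conj_dom"
  shows "((\<lambda>y. conj_c (x, y)) has_derivative (\<lambda>Y. D_conj Y (x, y))) (at y)"
proof -
  note * = conj_c_eq[OF assms]
  have 1: "((\<lambda>y. mul_c (x, y)) has_derivative (\<lambda>Y. frechet_derivative mul_c (at (x, y)) (0, Y))) (at y)"
  proof -
    have "((\<lambda>y. (x, y)) has_derivative (\<lambda>Y. (0, Y))) (at y)"
      by (auto intro!: derivative_eq_intros)
    from has_derivative_compose[OF this mul_c_differentiable[OF *(2), unfolded frechet_derivative_works]]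
    show ?thesis by simp
  qed
  have "((\<lambda>y. (mul_c (x, y), inv_c x)) has_derivative
      (\<lambda>Y. (frechet_derivative mul_c (at (x, y)) (0, Y), 0))) (at y)"
    by (intro has_derivative_Pair 1) auto
  from has_derivative_compose[OF this, of mul_c] mul_c_differentiable[OF *(3), unfolded frechet_derivative_works]
  have 2: "((\<lambda>y. mul_c (mul_c (x, y), inv_c x)) has_derivative (\<lambda>Y. D_conj Y (x, y))) (at y)"
    by (simp add: D_conj_def)
  show ?thesis
  proof (rule has_derivative_transform_within_open[OF 2])
    show "open (Pair x -` conj_dom)"
      by (intro open_vimage open_conj_dom continuous_intros)
  qed (use assms conj_c_eq in auto)
qed

lemma D_conj_differentiable:
  assumes "p \<in> conj_dom"
  shows "D_conj Y differentiable at p"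
proof -
  note * = conj_c_eq[OF assms]
  have ev: "eventually (\<lambda>q. q \<in> conj_dom) (nhds p)"
    using open_conj_dom assms by (rule eventually_nhds_in_open)
  have i: "inv_c differentiable at (fst p)"
    using assms by (intro inv_c_differentiable) (auto simp: conj_dom_def)
  have "(\<lambda>q. (mul_c q, inv_c (fst q))) differentiable at p"
  proof (rule differentiable_Pair)
    show "mul_c differentiable at p" by (rule mul_c_differentiable[OF *(2)])
    have "fst differentiable at p"
      unfolding differentiable_def using has_derivative_fst[OF has_derivative_ident] by blast
    from differentiable_chain_at[OF this i] show "(\<lambda>q. inv_c (fst q)) differentiable at p"
      by (simp add: o_def)
  qed
  moreover have "(\<lambda>q. (frechet_derivative mul_c (at q) (0, Y), 0::'e)) differentiable at p"
    by (intro differentiable_Pair D_mul_c_differentiable *) auto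
  moreover have "eventually (\<lambda>q. mul_c differentiable at (mul_c q, inv_c (fst q))) (nhds p)"
    using ev by eventually_elim (intro mul_c_differentiable conj_c_eq)
  ultimately show ?thesis
    unfolding D_conj_def[abs_def]
    by (rule differentiable_frechet_apply) (intro D_mul_c_differentiable *)
qed

text \<open>A formula for \<open>Ad\<close> near the identity in one fixed chart, so that
  differentiability and continuity in the group variable follow from those of
  \<open>D_conj\<close>.\<close>

lemma Ad_pt:
  assumes "x \<in> O0" "inv (pt x) \<in> U0"
  shows "Ad G (pt x) Y = D_conj Y (x, e0)"
proof -
  have "((\<lambda>y. conj_c (x, y)) has_derivative (\<lambda>Y. D_conj Y (x, e0))) (at e0)"
    using assms by (intro conj_c_derivative_snd conj_dom_e0)
  from frechet_derivative_at[OF this] have "frechet_derivative (\<lambda>y. conj_c (x, y)) (at e0) = (\<lambda>Y. D_conj Y (x, e0))" ..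
  then show ?thesis unfolding Ad_def tangent_map_def
    by (simp add: conj_c_def o_def fun_eq_iff)
qed

end

subsection \<open>Tangent maps and the bracket\<close>

context lie_grp
begin

text \<open>The maps for which \<open>tangent_map\<close> is a genuine derivative; without
  differentiability \<open>frechet_derivative\<close> is an arbitrary choice.\<close>

definition tangential :: "('g \<Rightarrow> 'g) \<Rightarrow> bool" where
  "tangential f \<longleftrightarrow> continuous_map (topo G) (topo G) f \<and> f \<one> = \<one> \<and>
     (crd \<circ> f \<circ> pt) differentiable at e0"

lemma tangential_derivative:
  assumes "tangential f"
  shows "((crd \<circ> f \<circ> pt) has_derivative tangent_map G f) (at e0)"
  using assms unfolding tangential_def tangent_map_def frechet_derivative_works by simp

lemma linear_tangent_map: "tangential f \<Longrightarrow> linear (tangent_map G f)"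
  using tangential_derivative has_derivative_linear by blast

lemma tangential_eventually:
  assumes "tangential f"
  shows "eventually (\<lambda>x. x \<in> O0 \<and> f (pt x) \<in> U0) (nhds e0)"
  using assms one_in_U0 chart_openin[OF id_chart_in]
  by (intro eventually_pt) (auto simp: tangential_def)

lemma eventually_O0: "eventually (\<lambda>x. x \<in> O0) (nhds e0)"
  by (rule eventually_nhds_in_open[OF open_O0 e0_in])

lemma tangent_map_eqI:
  assumes "((crd \<circ> f \<circ> pt) has_derivative D) (at e0)" "\<And>g. g \<in> carrier G \<Longrightarrow> f g = h g"
  shows "tangent_map G h = D"
proof -
  have "((crd \<circ> h \<circ> pt) has_derivative D) (at e0)"
    using assms(1)
    by (rule has_derivative_eventually_eq)
      (use eventually_O0 in eventually_elim, use assms(2) in auto)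
  from frechet_derivative_at[OF this] show ?thesis unfolding tangent_map_def ..
qed

text \<open>The chain rule in coordinates produces \<open>pt (crd (h (pt x)))\<close> as
  intermediate point. It collapses to \<open>h (pt x)\<close> only while that point lies in
  \<open>U0\<close>, which continuity of \<open>h\<close> ensures near \<open>e0\<close>.\<close>

lemma tangential_compose_derivative:
  assumes f: "tangential f" and h: "tangential h"
  shows "((crd \<circ> (f \<circ> h) \<circ> pt) has_derivative (tangent_map G f \<circ> tangent_map G h)) (at e0)"
proof -
  have "(crd \<circ> h \<circ> pt) e0 = e0" using h by (simp add: tangential_def)
  then have "((crd \<circ> f \<circ> pt) \<circ> (crd \<circ> h \<circ> pt) has_derivative (tangent_map G f \<circ> tangent_map G h)) (at e0)"
    using tangential_derivative[OF f] tangential_derivative[OF h] by (intro diff_chain_at) auto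
  then show ?thesis
    by (rule has_derivative_eventually_eq) (use tangential_eventually[OF h] in eventually_elim, auto)
qed

lemma tangent_map_compose:
  assumes "tangential f" "tangential h"  "\<And>g. g \<in> carrier G \<Longrightarrow> k g = f (h g)"
  shows "tangent_map G k = tangent_map G f \<circ> tangent_map G h"
  using assms by (intro tangent_map_eqI[OF tangential_compose_derivative]) auto

lemma tangent_map_curve:
  assumes f: "tangential f" and \<gamma>: "continuous_map euclideanreal (topo G) \<gamma>" "\<gamma> 0 = \<one>"
    and d: "((crd \<circ> \<gamma>) has_vector_derivative X) (at 0)"
  shows "((crd \<circ> (f \<circ> \<gamma>)) has_vector_derivative tangent_map G f X) (at 0)"
proof -
  have "((crd \<circ> f \<circ> pt) has_derivative tangent_map G f) (at ((crd \<circ> \<gamma>) 0))"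
    using \<gamma>(2) tangential_derivative[OF f] by simp
  from diff_chain_at[OF d[unfolded has_vector_derivative_def] this]
  have "((crd \<circ> f \<circ> pt) \<circ> (crd \<circ> \<gamma>) has_derivative tangent_map G f \<circ> (\<lambda>t. t *\<^sub>R X)) (at 0)" .
  moreover have "tangent_map G f \<circ> (\<lambda>t. t *\<^sub>R X) = (\<lambda>t. t *\<^sub>R tangent_map G f X)"
    using linear_tangent_map[OF f] by (auto simp: linear_scale)
  moreover have "eventually (\<lambda>t. \<gamma> t \<in> U0) (nhds 0)"
  proof -
    have "open {t \<in> UNIV. \<gamma> t \<in> U0}"
      using \<gamma>(1) by (intro open_chart_preimage[OF _ _ id_chart_in]) auto
    from eventually_nhds_in_open[OF this, of 0] show ?thesis
      using \<gamma>(2) one_in_U0 by simp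
  qed
  then have "eventually (\<lambda>t. ((crd \<circ> f \<circ> pt) \<circ> (crd \<circ> \<gamma>)) t = (crd \<circ> (f \<circ> \<gamma>)) t) (nhds 0)"
    by eventually_elim auto
  ultimately show ?thesis
    unfolding has_vector_derivative_def using has_derivative_eventually_eq by metis
qed

section \<open>The adjoint representation\<close>

abbreviation "cj g \<equiv> (\<lambda>x. g \<otimes> x \<otimes> inv g)"

text \<open>For \<open>g\<close> far from the identity the product \<open>g x\<close> leaves the
  identity chart. Conjugation is therefore split into left multiplication, landing in a chart around
  \<open>g\<close>, followed by right multiplication by \<open>inv g\<close>, leading back to the
  identity chart.\<close>

lemma tangential_conj:
  assumes g: "g \<in> carrier G"
  shows "tangential (cj g)"
proof -
  have cg: "continuous_map (topo G) (topo G) (\<lambda>x. g \<otimes> x)"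
    by (rule continuous_map_mult) (use g in auto)
  have c: "continuous_map (topo G) (topo G) (cj g)"
    by (intro continuous_map_mult) (use g in auto)
  obtain V \<psi> where V: "(V, \<psi>) \<in> atlas G" "g \<in> V"
    using atlas_covers g by blast
  obtain V' \<psi>' where V': "(V', \<psi>') \<in> atlas G" "inv g \<in> V'"
    using atlas_covers g by (meson inv_closed)
  have [simp]: "inv_into V \<psi> (\<psi> x) = x" if "x \<in> V" for x
    using chart_inj[OF V(1)] that by simp
  have [simp]: "inv_into V' \<psi>' (\<psi>' x) = x" if "x \<in> V'" for x
    using chart_inj[OF V'(1)] that by simp
  have 1: "(\<lambda>y. \<psi> (g \<otimes> pt y)) differentiable at e0"
  proof -
    have "(\<lambda>(x, y). \<psi> (inv_into V \<psi> x \<otimes> inv_into U0 crd y)) differentiable at (\<psi> g, crd \<one>)"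
      using V g one_in_U0 id_chart_in by (intro mult_differentiable) auto
    moreover have "(\<lambda>y. (\<psi> g, y)) differentiable at e0"
      by (intro differentiable_Pair) auto
    ultimately have "(\<lambda>(x, y). \<psi> (inv_into V \<psi> x \<otimes> inv_into U0 crd y)) \<circ> (\<lambda>y. (\<psi> g, y)) differentiable at e0"
      by (intro differentiable_chain_at) auto
    then show ?thesis using V by (simp add: o_def of_coord_def)
  qed
  have 2: "(\<lambda>y. crd (inv_into V \<psi> y \<otimes> inv g)) differentiable at (\<psi> g)"
  proof -
    have "(\<lambda>(x, y). crd (inv_into V \<psi> x \<otimes> inv_into V' \<psi>' y)) differentiable at (\<psi> g, \<psi>' (inv g))"
      using V V' g one_in_U0 id_chart_in by (intro mult_differentiable) auto
    moreover have "(\<lambda>y. (y, \<psi>' (inv g))) differentiable at (\<psi> g)"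
      by (intro differentiable_Pair) auto
    ultimately have "(\<lambda>(x, y). crd (inv_into V \<psi> x \<otimes> inv_into V' \<psi>' y)) \<circ> (\<lambda>y. (y, \<psi>' (inv g))) differentiable at (\<psi> g)"
      by (intro differentiable_chain_at) auto
    then show ?thesis using V' by (simp add: o_def)
  qed
  have "(\<lambda>y. crd (inv_into V \<psi> y \<otimes> inv g)) \<circ> (\<lambda>y. \<psi> (g \<otimes> pt y)) differentiable at e0"
    using 1 2 g by (intro differentiable_chain_at) auto
  then obtain D where D: "((\<lambda>y. crd (inv_into V \<psi> y \<otimes> inv g)) \<circ> (\<lambda>y. \<psi> (g \<otimes> pt y)) has_derivative D) (at e0)"
    unfolding differentiable_def by blast
  have "eventually (\<lambda>x. x \<in> O0 \<and> g \<otimes> pt x \<in> V) (nhds e0)"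
    using V g by (intro eventually_pt cg chart_openin) auto
  then have "eventually (\<lambda>x. ((\<lambda>y. crd (inv_into V \<psi> y \<otimes> inv g)) \<circ> (\<lambda>y. \<psi> (g \<otimes> pt y))) x
      = (crd \<circ> cj g \<circ> pt) x) (nhds e0)"
    by eventually_elim auto
  with D have "((crd \<circ> cj g \<circ> pt) has_derivative D) (at e0)"
    by (rule has_derivative_eventually_eq)
  then show ?thesis
    using c g unfolding tangential_def differentiable_def by auto
qed

lemma linear_Ad: "g \<in> carrier G \<Longrightarrow> linear (Ad G g)"
  unfolding Ad_def by (intro linear_tangent_map tangential_conj)

lemma Ad_mult:
  assumes "g \<in> carrier G" "h \<in> carrier G"
  shows "Ad G (g \<otimes> h) Y = Ad G g (Ad G h Y)"
proof -
  have "tangent_map G (cj (g \<otimes> h)) = tangent_map G (cj g) \<circ> tangent_map G (cj h)"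
    using assms
    by (intro tangent_map_compose tangential_conj) (auto simp: m_assoc inv_mult_group)
  then show ?thesis by (simp add: Ad_def)
qed

lemma tangent_map_id:
  assumes "\<And>g. g \<in> carrier G \<Longrightarrow> f g = g"
  shows "tangent_map G f = id"
proof (rule tangent_map_eqI[where f = id])
  show "((crd \<circ> id \<circ> pt) has_derivative id) (at e0)"
    by (rule has_derivative_eventually_eq[where f = id])
      (use eventually_O0 in \<open>auto elim: eventually_mono\<close>)
qed (simp add: assms)

lemma Ad_one [simp]: "Ad G \<one> Y = Y"
  unfolding Ad_def by (subst tangent_map_id) auto

text \<open>Differentiates the identity \<open>f (g x g^-1) = f g f x (f g)^-1\<close> in
  \<open>x\<close> at the identity.\<close>

lemma tangent_map_Ad:
  assumes f: "tangential f" "f \<in> hom G G" and g: "g \<in> carrier G"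
  shows "tangent_map G f (Ad G g Y) = Ad G (f g) (tangent_map G f Y)"
proof -
  interpret f: group_hom G G f
    using f(2) by (simp add: group_hom_def group_hom_axioms_def is_group)
  have "tangent_map G (\<lambda>x. f (cj g x)) = tangent_map G f \<circ> tangent_map G (cj g)"
    using g by (intro tangent_map_compose f tangential_conj) auto
  moreover have "tangent_map G (\<lambda>x. f (cj g x)) = tangent_map G (cj (f g)) \<circ> tangent_map G f"
    using g by (intro tangent_map_compose f tangential_conj) auto
  ultimately show ?thesis by (simp add: Ad_def fun_eq_iff)
qed

section \<open>The bracket as the derivative of the adjoint representation\<close>

lemma eventually_conj_dom_fst: "eventually (\<lambda>x. x \<in> O0 \<and> inv (pt x) \<in> U0) (nhds e0)"
  using one_in_U0 by (intro eventually_pt inv_continuous chart_openin[OF id_chart_in]) auto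

lemma Ad_pt_derivative: "((\<lambda>x. Ad G (pt x) Y) has_derivative (\<lambda>X. bracket G X Y)) (at e0)"
proof -
  have "D_conj Y differentiable at (e0, e0)"
    by (intro D_conj_differentiable conj_dom_e0) auto
  moreover have "(\<lambda>x. (x, e0)) differentiable at e0"
    by (intro differentiable_Pair) auto
  ultimately have "D_conj Y \<circ> (\<lambda>x. (x, e0)) differentiable at e0"
    by (intro differentiable_chain_at) auto
  then obtain D where "(D_conj Y \<circ> (\<lambda>x. (x, e0)) has_derivative D) (at e0)"
    unfolding differentiable_def by blast
  then have D: "((\<lambda>x. Ad G (pt x) Y) has_derivative D) (at e0)"
    by (rule has_derivative_eventually_eq)
      (use eventually_conj_dom_fst in eventually_elim, auto simp: Ad_pt)
  have "D = (\<lambda>X. bracket G X Y)"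
    unfolding bracket_def using frechet_derivative_at[OF D] by simp
  with D show ?thesis by simp
qed

lemma bracket_eqI:
  assumes "((\<lambda>x. Ad G (pt x) Y) has_derivative D) (at e0)"
  shows "bracket G X Y = D X"
  using has_derivative_unique[OF Ad_pt_derivative assms] by metis

lemma linear_bracket_left: "linear (\<lambda>X. bracket G X Y)"
  using Ad_pt_derivative has_derivative_linear by blast

lemma linear_bracket_right: "linear (\<lambda>Y. bracket G X Y)"
proof (rule linearI)
  fix Y Z c
  show "bracket G X (Y + Z) = bracket G X Y + bracket G X Z"
    by (rule bracket_eqI[where D = "\<lambda>X. bracket G X Y + bracket G X Z"],
      rule has_derivative_eventually_eq[OF has_derivative_add[OF Ad_pt_derivative Ad_pt_derivative]],
      use eventually_O0 in eventually_elim) (simp add: linear_Ad linear_add)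
  show "bracket G X (c *\<^sub>R Y) = c *\<^sub>R bracket G X Y"
    by (rule bracket_eqI[where D = "\<lambda>X. c *\<^sub>R bracket G X Y"],
      rule has_derivative_eventually_eq[OF has_derivative_scaleR_right[OF Ad_pt_derivative]],
      use eventually_O0 in eventually_elim) (simp add: linear_Ad linear_scale)
qed

lemma bilinear_bracket: "bilinear (bracket G)"
  using linear_bracket_left linear_bracket_right by (auto simp: bilinear_def)

text \<open>Differentiates the equivariance \<open>tangent_map_Ad\<close> once more, now in the
  group variable \<open>g\<close> at the identity.\<close>

lemma tangent_map_bracket:
  assumes f: "tangential f" "f \<in> hom G G"
  shows "tangent_map G f (bracket G X Y) = bracket G (tangent_map G f X) (tangent_map G f Y)"
proof -
  let ?T = "tangent_map G f"
  have 1: "((\<lambda>x. ?T (Ad G (pt x) Y)) has_derivative (\<lambda>X. ?T (bracket G X Y))) (at e0)"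
    using linear_tangent_map[OF f(1)] Ad_pt_derivative bounded_linear.has_derivative linear_conv_bounded_linear
    by blast
  have e: "(crd \<circ> f \<circ> pt) e0 = e0" using f(1) by (simp add: tangential_def)
  have "((\<lambda>x. Ad G (pt x) (?T Y)) has_derivative (\<lambda>X. bracket G X (?T Y))) (at ((crd \<circ> f \<circ> pt) e0))"
    unfolding e by (rule Ad_pt_derivative)
  from diff_chain_at[OF tangential_derivative[OF f(1)] this]
  have "((\<lambda>x. ?T (Ad G (pt x) Y)) has_derivative (\<lambda>X. bracket G X (?T Y)) \<circ> ?T) (at e0)"
    by (rule has_derivative_eventually_eq)
      (use tangential_eventually[OF f(1)] in eventually_elim, auto simp: tangent_map_Ad f)
  from has_derivative_unique[OF 1 this] show ?thesis by (simp add: fun_eq_iff)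
qed

lemma hom_conj: "g \<in> carrier G \<Longrightarrow> cj g \<in> hom G G"
  by (rule homI) (auto simp: m_assoc inv_solve_left)

lemma Ad_bracket: "g \<in> carrier G \<Longrightarrow> Ad G g (bracket G X Y) = bracket G (Ad G g X) (Ad G g Y)"
  unfolding Ad_def by (intro tangent_map_bracket tangential_conj hom_conj)

lemma has_derivative_bilinear_Ad:
  assumes "bilinear B"
  shows "((\<lambda>x. B (Ad G (pt x) X) (Ad G (pt x) Y)) has_derivative
     (\<lambda>H. B X (bracket G H Y) + B (bracket G H X) Y)) (at e0)"
  using bounded_bilinear.FDERIV[OF assms[unfolded bilinear_conv_bounded_bilinear]
      Ad_pt_derivative[of X] Ad_pt_derivative[of Y]] by simp

text \<open>The infinitesimal form of the fact that \<open>Ad\<close> acts by automorphisms of the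
  bracket: both sides of \<open>Ad_bracket\<close> are differentiated at the identity, the right one
  by the product rule.\<close>

lemma jacobi: "bracket G H (bracket G X Y) = bracket G (bracket G H X) Y + bracket G X (bracket G H Y)"
proof -
  have "((\<lambda>x. Ad G (pt x) (bracket G X Y)) has_derivative
     (\<lambda>H. bracket G X (bracket G H Y) + bracket G (bracket G H X) Y)) (at e0)"
    by (rule has_derivative_eventually_eq[OF has_derivative_bilinear_Ad[OF bilinear_bracket]])
     (use eventually_O0 in eventually_elim, simp add: Ad_bracket)
  from bracket_eqI[OF this] show ?thesis by simp
qed

text \<open>The function \<open>B (Ad g X) (Ad g Y)\<close> of \<open>g\<close> is constant, so its
  derivative at the identity vanishes.\<close>

lemma bracket_skew:
  assumes "Ad_invariant_inner_product G B"
  shows "B (bracket G H X) Y = - B X (bracket G H Y)"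
proof -
  have B: "bilinear B" "\<And>g X Y. g \<in> carrier G \<Longrightarrow> B (Ad G g X) (Ad G g Y) = B X Y"
    using assms by (auto simp: Ad_invariant_inner_product_def)
  have "((\<lambda>x. B X Y) has_derivative (\<lambda>H. B X (bracket G H Y) + B (bracket G H X) Y)) (at e0)"
    by (rule has_derivative_eventually_eq[OF has_derivative_bilinear_Ad[OF B(1)]])
     (use eventually_O0 in eventually_elim, simp add: B)
  from has_derivative_unique[OF this has_derivative_const]
  have "B X (bracket G H Y) + B (bracket G H X) Y = 0" by metis
  then show ?thesis by simp
qed

text \<open>Antisymmetry is not visible in a bracket defined as the derivative of \<open>Ad\<close>.
  It is extracted here, in the form that polarizes, from the second-order behaviour of conjugation
  along a line in the chart.\<close>

lemma bracket_self: "bracket G X X = 0"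
proof -
  \<comment> \<open>\<open>D\<close> splits into two partial derivatives: the one in the conjugating
    variable is the bracket with \<open>X\<close>, and the other vanishes because conjugation by the
    identity has derivative \<open>X\<close> in direction \<open>X\<close> at every point.\<close>
  define D where "D = frechet_derivative (D_conj X) (at (e0, e0))"
  have D: "(D_conj X has_derivative D) (at (e0, e0))"
    using D_conj_differentiable[OF conj_dom_e0(2)[OF e0_in]] unfolding D_def frechet_derivative_works .
  have D1: "D (Z, 0) = bracket G Z X" for Z
  proof -
    have "((\<lambda>x. (x, e0)) has_derivative (\<lambda>Z. (Z, 0))) (at e0)"
      by (auto intro!: derivative_eq_intros)
    from has_derivative_compose[OF this D]
    have "((\<lambda>x. Ad G (pt x) X) has_derivative (\<lambda>Z. D (Z, 0))) (at e0)"
      by (rule has_derivative_eventually_eq)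
        (use eventually_conj_dom_fst in eventually_elim, auto simp: Ad_pt)
    from bracket_eqI[OF this] show ?thesis by simp
  qed
  have Dconj_e0: "D_conj X (e0, y) = X" if y: "y \<in> O0" for y
  proof -
    have "((\<lambda>y. conj_c (e0, y)) has_derivative id) (at y)"
      by (rule has_derivative_transform_within_open[OF _ open_O0 y, of id])
         (auto simp: conj_c_def)
    from has_derivative_unique[OF conj_c_derivative_snd[OF conj_dom_e0(2)[OF y]] this]
    show ?thesis by (simp add: fun_eq_iff)
  qed
  have D2: "D (0, Z) = 0" for Z
  proof -
    have "((\<lambda>y. (e0, y)) has_derivative (\<lambda>Z. (0, Z))) (at e0)"
      by (auto intro!: derivative_eq_intros)
    from has_derivative_compose[OF this D]
    have "((\<lambda>y. X) has_derivative (\<lambda>Z. D (0, Z))) (at e0)"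
      by (rule has_derivative_eventually_eq)
        (use eventually_O0 in eventually_elim, auto simp: Dconj_e0)
    from has_derivative_unique[OF this has_derivative_const] show ?thesis by metis
  qed
  have linD: "linear D" using D has_derivative_linear by blast
  have Dst: "D (t *\<^sub>R X, s *\<^sub>R X) = t *\<^sub>R bracket G X X" for s t
  proof -
    have "D (t *\<^sub>R X, s *\<^sub>R X) = D (t *\<^sub>R X, 0) + D (0, s *\<^sub>R X)"
      by (simp flip: linear_add[OF linD])
    then show ?thesis
      unfolding D1 D2 by (simp add: linear_scale[OF linear_bracket_left])
  qed
  have D00: "D_conj X (e0, e0) = X" by (simp add: Dconj_e0)
  \<comment> \<open>In the chart, \<open>F(x, y) = x y x\<^sup>-\<^sup>1\<close> satisfies \<open>F(x, x) = x\<close> and \<open>F(x, e) = e\<close>, while its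
    \<open>y\<close>-derivative at \<open>(e + t X, e + s X)\<close> in direction \<open>X\<close> is \<open>X + t [X, X] + o(|s| + |t|)\<close>;
    integrating over \<open>0 \<le> s \<le> t\<close> gives \<open>t\<^sup>2 [X, X] = o(t\<^sup>2)\<close>.\<close>
  have "norm (bracket G X X) \<le> \<epsilon>" if "\<epsilon> > 0" for \<epsilon>
  proof -
    \<comment> \<open>The summand 1 keeps the denominator positive when
      \<open>X = 0\<close>.\<close>
    define \<eta> where "\<eta> = \<epsilon> / (2 * norm X + 1)"
    have \<eta>: "\<eta> > 0" "\<eta> * (2 * norm X) \<le> \<epsilon>"
      unfolding \<eta>_def using that by (auto simp: field_simps add_pos_nonneg)
    have "eventually (\<lambda>p. norm (D_conj X p - D_conj X (e0, e0) - D (p - (e0, e0))) \<le> \<eta> * norm (p - (e0, e0))) (nhds (e0, e0))"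
      using D \<eta>(1) unfolding has_derivative_at_alt eventually_nhds_metric dist_norm by metis
    moreover have "eventually (\<lambda>p. p \<in> conj_dom) (nhds (e0, e0))"
      using open_conj_dom conj_dom_e0(2)[OF e0_in] by (rule eventually_nhds_in_open)
    ultimately have "eventually (\<lambda>p. p \<in> conj_dom \<and>
       norm (D_conj X p - X - D (p - (e0, e0))) \<le> \<eta> * norm (p - (e0, e0))) (nhds (e0, e0))"
      unfolding D00 by eventually_elim auto
    then obtain d where d: "d > 0" and dd: "\<And>p. dist p (e0, e0) < d \<Longrightarrow> p \<in> conj_dom \<and>
       norm (D_conj X p - X - D (p - (e0, e0))) \<le> \<eta> * norm (p - (e0, e0))"
      unfolding eventually_nhds_metric by blast
    \<comment> \<open>This size keeps all pairs \<open>(e0 + t X, e0 + s X)\<close> with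
      \<open>s\<close> between 0 and \<open>t\<close> within distance \<open>d\<close> of
      \<open>(e0, e0)\<close>; the factor 2 comes from bounding the norm of a pair by the sum of the
      norms.\<close>
    define t where "t = d / (2 * norm X + 1) / 2"
    have t: "t > 0" "t * (2 * norm X) < d"
      unfolding t_def using d by (auto simp: field_simps add_pos_nonneg)
    define x where "x = e0 + t *\<^sub>R X"
    have bnd: "norm (t *\<^sub>R X, s *\<^sub>R X) \<le> t * (2 * norm X)" if "s \<in> {0..t}" for s
    proof -
      have "norm (t *\<^sub>R X, s *\<^sub>R X) \<le> norm (t *\<^sub>R X) + norm (s *\<^sub>R X)" by (rule norm_Pair_le)
      also have "\<dots> = t * norm X + s * norm X" using that t by simp
      also have "\<dots> \<le> t * (2 * norm X)" using that mult_right_mono[of s t "norm X"] by simp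
      finally show ?thesis .
    qed
    have near: "(x, e0 + s *\<^sub>R X) \<in> conj_dom"
      "norm (D_conj X (x, e0 + s *\<^sub>R X) - X - t *\<^sub>R bracket G X X) \<le> \<eta> * (t * (2 * norm X))"
      if s: "s \<in> {0..t}" for s
    proof -
      have eq: "(x, e0 + s *\<^sub>R X) - (e0, e0) = (t *\<^sub>R X, s *\<^sub>R X)" by (simp add: x_def)
      have "dist (x, e0 + s *\<^sub>R X) (e0, e0) < d"
        unfolding dist_norm eq using bnd[OF s] t by linarith
      from dd[OF this] have *: "(x, e0 + s *\<^sub>R X) \<in> conj_dom"
        "norm (D_conj X (x, e0 + s *\<^sub>R X) - X - t *\<^sub>R bracket G X X) \<le> \<eta> * norm (t *\<^sub>R X, s *\<^sub>R X)"
        unfolding eq Dst by auto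
      then show "(x, e0 + s *\<^sub>R X) \<in> conj_dom" by simp
      show "norm (D_conj X (x, e0 + s *\<^sub>R X) - X - t *\<^sub>R bracket G X X) \<le> \<eta> * (t * (2 * norm X))"
        using *(2) bnd[OF s] \<eta>(1) by (meson mult_left_mono less_imp_le order_trans)
    qed
    \<comment> \<open>The deviation of conjugation along the segment from its predicted linear
      growth. Its derivative is small, so the mean value inequality replaces the
      integration.\<close>
    define u where "u s = conj_c (x, e0 + s *\<^sub>R X) - s *\<^sub>R (X + t *\<^sub>R bracket G X X)" for s
    have "norm (u t - u 0) \<le> \<eta> * (t * (2 * norm X)) * norm (t - 0)"
    proof (rule differentiable_bound[of "{0..t}"])
      fix s assume s: "s \<in> {0..t}"
      have "((\<lambda>s. e0 + s *\<^sub>R X) has_derivative (\<lambda>h. h *\<^sub>R X)) (at s)"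
        by (auto intro!: derivative_eq_intros)
      from has_derivative_compose[OF this conj_c_derivative_snd[OF near(1)[OF s]]]
      have 1: "((\<lambda>s. conj_c (x, e0 + s *\<^sub>R X)) has_derivative (\<lambda>h. D_conj (h *\<^sub>R X) (x, e0 + s *\<^sub>R X))) (at s)" .
      have lin: "linear (\<lambda>Y. D_conj Y (x, e0 + s *\<^sub>R X))"
        using conj_c_derivative_snd[OF near(1)[OF s]] has_derivative_linear by blast
      have "(u has_derivative (\<lambda>h. D_conj (h *\<^sub>R X) (x, e0 + s *\<^sub>R X) - h *\<^sub>R (X + t *\<^sub>R bracket G X X))) (at s)"
        unfolding u_def by (intro has_derivative_diff 1 has_derivative_scaleR_left has_derivative_ident)
      also have "(\<lambda>h. D_conj (h *\<^sub>R X) (x, e0 + s *\<^sub>R X) - h *\<^sub>R (X + t *\<^sub>R bracket G X X))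
         = (\<lambda>h. h *\<^sub>R (D_conj X (x, e0 + s *\<^sub>R X) - X - t *\<^sub>R bracket G X X))"
        using linear_scale[OF lin] by (simp add: algebra_simps)
      finally show "(u has_derivative (\<lambda>h. h *\<^sub>R (D_conj X (x, e0 + s *\<^sub>R X) - X - t *\<^sub>R bracket G X X))) (at s within {0..t})"
        by (rule has_derivative_at_withinI)
      show "onorm (\<lambda>h::real. h *\<^sub>R (D_conj X (x, e0 + s *\<^sub>R X) - X - t *\<^sub>R bracket G X X)) \<le> \<eta> * (t * (2 * norm X))"
        using near(2)[OF s] by (intro onorm_le) (simp add: mult.commute mult_left_mono)
    qed (use t in auto)
    moreover have "x \<in> O0" using near(1)[of t] t by (simp add: x_def conj_dom_def)
    then have "u t - u 0 = - (t * t) *\<^sub>R bracket G X X"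
      using t unfolding u_def by (simp flip: x_def) (simp add: conj_c_def m_assoc x_def algebra_simps)
    ultimately have "(t * t) * norm (bracket G X X) \<le> (t * t) * (\<eta> * (2 * norm X))"
      using t by (simp add: mult_ac)
    then have "norm (bracket G X X) \<le> \<eta> * (2 * norm X)"
      using t by simp
    then show ?thesis using \<eta> by simp
  qed
  then have "norm (bracket G X X) \<le> 0"
    by (rule field_le_epsilon[of _ 0, simplified])
  then show ?thesis by simp
qed

lemma bracket_antisym: "bracket G X Y = - bracket G Y X"
proof -
  have "bracket G (X + Y) (X + Y) = bracket G X Y + bracket G Y X"
    unfolding linear_add[OF linear_bracket_left] linear_add[OF linear_bracket_right]
    by (simp add: bracket_self)
  then show ?thesis by (simp add: bracket_self eq_neg_iff_add_eq_0)
qed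

end

subsection \<open>Products of small steps\<close>

text \<open>In finite dimension differentiability on each vector is uniform on bounded sets: the
  estimate is made on the finitely many basis vectors with error \<epsilon> divided by the
  dimension, and then summed. Only small positive \<open>h\<close> are considered, since the maps
  \<open>A h\<close> are linear only for those.\<close>

lemma linear_approximation_uniform:
  fixes A :: "real \<Rightarrow> 'e::euclidean_space \<Rightarrow> 'e"
  assumes lin: "eventually (\<lambda>h. linear (A h)) (at_right 0)" and L: "linear L"
    and A0: "\<And>v. A 0 v = v" and der: "\<And>v. ((\<lambda>h. A h v) has_vector_derivative L v) (at 0)"
    and "\<epsilon> > 0"
  shows "eventually (\<lambda>h. \<forall>v. norm (A h v - v - h *\<^sub>R L v) \<le> \<epsilon> * h * norm v) (at_right 0)"
proof -
  define \<epsilon>' where "\<epsilon>' = \<epsilon> / DIM('e)"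
  have \<epsilon>': "\<epsilon>' > 0" using \<open>\<epsilon> > 0\<close> by (simp add: \<epsilon>'_def)
  have "eventually (\<lambda>h. norm (A h b - b - h *\<^sub>R L b) \<le> \<epsilon>' * h) (at_right 0)" for b
  proof -
    obtain d where d: "d > 0" "\<And>h. norm (h - 0) < d \<Longrightarrow> norm (A h b - A 0 b - (h - 0) *\<^sub>R L b) \<le> \<epsilon>' * norm (h - 0)"
      using der[of b] \<epsilon>' unfolding has_vector_derivative_def has_derivative_at_alt by metis
    have "norm (A h b - b - h *\<^sub>R L b) \<le> \<epsilon>' * h" if "h > 0" "h < d" for h
      using d(2)[of h] that A0 by simp
    then show ?thesis
      unfolding eventually_at_right_field using d(1) by blast
  qed
  then have "eventually (\<lambda>h. \<forall>b\<in>Basis. norm (A h b - b - h *\<^sub>R L b) \<le> \<epsilon>' * h) (at_right 0)"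
    by (intro eventually_ball_finite) auto
  moreover have "eventually (\<lambda>h::real. h > 0) (at_right 0)"
    by (rule eventually_at_right_less)
  ultimately show ?thesis using lin
  proof eventually_elim
    case (elim h)
    show ?case
    proof
      fix v
      have "linear (\<lambda>v. A h v - v - h *\<^sub>R L v)"
        using elim(3) L by (intro linear_compose_sub linear_compose_scale_right linear_ident)
      then have "A h v - v - h *\<^sub>R L v = (\<Sum>b\<in>Basis. (v \<bullet> b) *\<^sub>R (A h b - b - h *\<^sub>R L b))"
        by (rule linear_Basis_expansion)
      also have "norm \<dots> \<le> (\<Sum>b\<in>(Basis::'e set). \<epsilon>' * h * norm v)"
      proof (rule sum_norm_le)
        fix b :: 'e assume b: "b \<in> Basis"
        have "norm ((v \<bullet> b) *\<^sub>R (A h b - b - h *\<^sub>R L b)) = \<bar>v \<bullet> b\<bar> * norm (A h b - b - h *\<^sub>R L b)"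
          by simp
        also have "\<dots> \<le> norm v * (\<epsilon>' * h)"
          using elim(1) b by (intro mult_mono Basis_le_norm) auto
        finally show "norm ((v \<bullet> b) *\<^sub>R (A h b - b - h *\<^sub>R L b)) \<le> \<epsilon>' * h * norm v"
          by (simp add: mult_ac)
      qed
      also have "\<dots> = \<epsilon> * h * norm v" by (simp add: \<epsilon>'_def)
      finally show "norm (A h v - v - h *\<^sub>R L v) \<le> \<epsilon> * h * norm v" .
    qed
  qed
qed

text \<open>Consistency of the scheme. Both \<open>A h (r s)\<close> and \<open>r (s + h)\<close>
  are compared with the tangent step \<open>r s + h L (r s)\<close>, each within half of the allowed
  error, uniformly in \<open>s\<close>.\<close>

lemma one_step_error:
  fixes A :: "real \<Rightarrow> 'e::euclidean_space \<Rightarrow> 'e"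
  assumes lin: "eventually (\<lambda>h. linear (A h)) (at_right 0)" and L: "linear L"
    and A0: "\<And>v. A 0 v = v" and der: "\<And>v. ((\<lambda>h. A h v) has_vector_derivative L v) (at 0)"
    and r: "\<And>s. (r has_vector_derivative L (r s)) (at s)"
    and "\<epsilon> > 0"
  shows "eventually (\<lambda>h. \<forall>s\<in>{0..t}. norm (A h (r s) - r (s + h)) \<le> \<epsilon> * h) (at_right 0)"
proof -
  have cr: "continuous_on S r" for S
    using r by (intro continuous_at_imp_continuous_on ballI) (metis has_vector_derivative_continuous)
  have "bounded (r ` {0..t})"
    by (intro compact_imp_bounded compact_continuous_image cr compact_Icc)
  then obtain K where K: "K > 0" "\<And>s. s \<in> {0..t} \<Longrightarrow> norm (r s) \<le> K"
    unfolding bounded_pos by auto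
  have ev1: "eventually (\<lambda>h. \<forall>v. norm (A h v - v - h *\<^sub>R L v) \<le> \<epsilon> / (2 * K) * h * norm v) (at_right 0)"
    using K \<open>\<epsilon> > 0\<close> by (intro linear_approximation_uniform[OF lin L A0 der]) auto
  \<comment> \<open>The interval is lengthened by 1 because \<open>s + h\<close> may exceed
    \<open>t\<close>; below, \<open>h < 1\<close> keeps it inside.\<close>
  have "continuous_on {0..t+1} (\<lambda>s. L (r s))"
    using continuous_on_compose2[OF linear_continuous_on[of L UNIV] cr] L
    by (auto simp: linear_conv_bounded_linear)
  then have "uniformly_continuous_on {0..t+1} (\<lambda>s. L (r s))"
    by (rule compact_uniformly_continuous) (rule compact_Icc)
  then obtain d where d: "d > 0" "\<And>s s'. s \<in> {0..t+1} \<Longrightarrow> s' \<in> {0..t+1} \<Longrightarrow> dist s' s < d \<Longrightarrow>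
      dist (L (r s')) (L (r s)) < \<epsilon> / 2"
    unfolding uniformly_continuous_on_def using \<open>\<epsilon> > 0\<close> by (metis half_gt_zero)
  have ev2: "eventually (\<lambda>h. 0 < h \<and> h < min d 1) (at_right 0)"
    using d(1) by (intro eventually_conj eventually_at_right_less eventually_at_rightI[of 0 "min d 1"]) auto
  from ev1 ev2 show ?thesis
  proof eventually_elim
    case (elim h)
    show ?case
    proof
      fix s assume s: "s \<in> {0..t}"
      have "norm (A h (r s) - r s - h *\<^sub>R L (r s)) \<le> \<epsilon> / (2 * K) * h * norm (r s)"
        using elim by blast
      also have "\<dots> \<le> \<epsilon> / (2 * K) * h * K"
        using K \<open>\<epsilon> > 0\<close> elim s by (intro mult_left_mono) auto
      finally have 1: "norm (A h (r s) - r s - h *\<^sub>R L (r s)) \<le> \<epsilon> / 2 * h"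
        using K by simp
      have "norm (r (s + h) - r s - (s + h - s) *\<^sub>R L (r s)) \<le> norm (s + h - s) * (\<epsilon> / 2)"
      proof (rule vector_differentiable_bound_linearization[where S = "{s..s+h}"])
        show "closed_segment s (s + h) \<subseteq> {s..s+h}"
          using elim by (simp add: closed_segment_eq_real_ivl)
        fix u assume u: "u \<in> {s..s+h}"
        show "(r has_vector_derivative L (r u)) (at u within {s..s+h})"
          using r has_vector_derivative_at_within by blast
        show "norm (L (r u) - L (r s)) \<le> \<epsilon> / 2"
          using d(2)[of s u] u s elim by (auto simp: dist_norm)
      qed (use elim in auto)
      then have 2: "norm (r (s + h) - r s - h *\<^sub>R L (r s)) \<le> \<epsilon> / 2 * h"
        using elim by (simp add: mult.commute)
      have "A h (r s) - r (s + h) = (A h (r s) - r s - h *\<^sub>R L (r s)) - (r (s + h) - r s - h *\<^sub>R L (r s))"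
        by simp
      then have "norm (A h (r s) - r (s + h)) \<le> norm (A h (r s) - r s - h *\<^sub>R L (r s)) + norm (r (s + h) - r s - h *\<^sub>R L (r s))"
        by (metis norm_triangle_ineq4)
      then show "norm (A h (r s) - r (s + h)) \<le> \<epsilon> * h" using 1 2 by linarith
    qed
  qed
qed

text \<open>Stability of the scheme: the error made in one step is carried along by the remaining
  powers of \<open>A\<close>. Since all powers share the bound \<open>M\<close>, the errors only add
  up and do not grow exponentially.\<close>

lemma power_step_error:
  fixes A :: "'e::real_normed_vector \<Rightarrow> 'e"
  assumes lin: "linear A" and bnd: "\<And>k v. norm ((A ^^ k) v) \<le> M * norm v" and "M \<ge> 0"
    and step: "\<And>s. s \<in> {0..t} \<Longrightarrow> norm (A (r s) - r (s + h)) \<le> \<delta>"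
    and "h \<ge> 0" "s \<ge> 0" "s + real j * h \<le> t"
  shows "norm ((A ^^ j) (r s) - r (s + real j * h)) \<le> real j * (M * \<delta>)"
  using \<open>s \<ge> 0\<close> \<open>s + real j * h \<le> t\<close>
proof (induction j arbitrary: s)
  case (Suc j)
  have lin': "linear (A ^^ j)"
    using lin by (induction j) (auto simp: linear_compose linear_id)
  have le: "s + h + real j * h \<le> t" using Suc.prems by (simp add: algebra_simps)
  have "(A ^^ Suc j) (r s) - r (s + real (Suc j) * h) =
     (A ^^ j) (A (r s) - r (s + h)) + ((A ^^ j) (r (s + h)) - r (s + h + real j * h))"
    by (simp add: funpow_swap1 linear_diff[OF lin'] algebra_simps)
  also have "norm \<dots> \<le> norm ((A ^^ j) (A (r s) - r (s + h))) + norm ((A ^^ j) (r (s + h)) - r (s + h + real j * h))"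
    by (rule norm_triangle_ineq)
  also have "\<dots> \<le> M * \<delta> + real j * (M * \<delta>)"
  proof (rule add_mono)
    have "0 \<le> real j * h" using \<open>h \<ge> 0\<close> by simp
    then have "s \<le> t" using le \<open>h \<ge> 0\<close> by linarith
    then have "s \<in> {0..t}" using Suc.prems(1) by simp
    then show "norm ((A ^^ j) (A (r s) - r (s + h))) \<le> M * \<delta>"
      using bnd[of j] step \<open>M \<ge> 0\<close> by (meson mult_left_mono order_trans)
    show "norm ((A ^^ j) (r (s + h)) - r (s + h + real j * h)) \<le> real j * (M * \<delta>)"
      using Suc.prems \<open>h \<ge> 0\<close> le by (intro Suc.IH) auto
  qed
  also have "\<dots> = real (Suc j) * (M * \<delta>)" by (simp add: algebra_simps)
  finally show ?case .
qed simp

lemma filterlim_over_Suc: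
  assumes "t > (0::real)"
  shows "filterlim (\<lambda>n. t / real (Suc n)) (at_right 0) sequentially"
  unfolding filterlim_at
proof
  show "eventually (\<lambda>n. t / real (Suc n) \<in> {0<..} \<and> t / real (Suc n) \<noteq> 0) sequentially"
    using assms by (intro always_eventually) auto
  show "(\<lambda>n. t / real (Suc n)) \<longlonglongrightarrow> 0"
    using LIMSEQ_Suc[OF lim_const_over_n[of t]] by simp
qed

lemma euler_scheme_converges:
  fixes A :: "real \<Rightarrow> 'e::euclidean_space \<Rightarrow> 'e"
  assumes A: "eventually (\<lambda>h. linear (A h) \<and> (\<forall>k v. norm ((A h ^^ k) v) \<le> M * norm v)) (at_right 0)"
    and L: "linear L"
    and A0: "\<And>v. A 0 v = v" and der: "\<And>v. ((\<lambda>h. A h v) has_vector_derivative L v) (at 0)"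
    and r: "\<And>s. (r has_vector_derivative L (r s)) (at s)"
    and "t > 0" "M > 0"
  shows "(\<lambda>n. (A (t / real (Suc n)) ^^ Suc n) (r 0)) \<longlonglongrightarrow> r t"
proof (rule tendstoI)
  fix \<eta> :: real assume "\<eta> > 0"
  \<comment> \<open>With \<open>Suc n\<close> steps of length \<open>t / Suc n\<close>, the
    accumulated error is at most \<open>M * \<epsilon> * t\<close>, which is half of \<eta>.\<close>
  define \<epsilon> where "\<epsilon> = \<eta> / (2 * M * t)"
  have \<epsilon>: "\<epsilon> > 0" using \<open>\<eta> > 0\<close> \<open>t > 0\<close> \<open>M > 0\<close> by (simp add: \<epsilon>_def)
  have lin: "eventually (\<lambda>h. linear (A h)) (at_right 0)"
    using A by (rule eventually_mono) simp
  have "eventually (\<lambda>h. (linear (A h) \<and> (\<forall>k v. norm ((A h ^^ k) v) \<le> M * norm v)) \<and>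
     (\<forall>s\<in>{0..t}. norm (A h (r s) - r (s + h)) \<le> \<epsilon> * h)) (at_right 0)"
    using A one_step_error[OF lin L A0 der r \<epsilon>] by (rule eventually_conj)
  moreover have "filterlim (\<lambda>n. t / real (Suc n)) (at_right 0) sequentially"
    using \<open>t > 0\<close> by (rule filterlim_over_Suc)
  ultimately have "eventually (\<lambda>n. (linear (A (t / real (Suc n))) \<and> (\<forall>k v. norm ((A (t / real (Suc n)) ^^ k) v) \<le> M * norm v)) \<and>
     (\<forall>s\<in>{0..t}. norm (A (t / real (Suc n)) (r s) - r (s + t / real (Suc n))) \<le> \<epsilon> * (t / real (Suc n)))) sequentially"
    by (rule eventually_compose_filterlim)
  then show "eventually (\<lambda>n. dist ((A (t / real (Suc n)) ^^ Suc n) (r 0)) (r t) < \<eta>) sequentially"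
  proof eventually_elim
    case (elim n)
    define h where "h = t / real (Suc n)"
    have ht: "real (Suc n) * h = t" unfolding h_def by simp
    have "norm ((A h ^^ Suc n) (r 0) - r (0 + real (Suc n) * h)) \<le> real (Suc n) * (M * (\<epsilon> * h))"
      using elim \<open>t > 0\<close> \<open>M > 0\<close> ht unfolding h_def[symmetric]
      by (intro power_step_error[where t = t]) (auto simp: h_def)
    also have "\<dots> = M * \<epsilon> * t" using ht by (metis mult.assoc mult.commute)
    also have "\<dots> < \<eta>" using \<open>\<eta> > 0\<close> \<open>t > 0\<close> \<open>M > 0\<close> by (simp add: \<epsilon>_def)
    finally show ?case unfolding ht h_def dist_norm by simp
  qed
qed

section \<open>Compactness of the adjoint group and realization of flows in it\<close>

context lie_grp
begin

text \<open>Near the identity the coordinate formula \<open>Ad_pt\<close> applies; elsewhere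
  continuity is transported by \<open>Ad h = Ad g (Ad (g^-1 h))\<close>, where \<open>g^-1 h\<close>
  is near the identity.\<close>

lemma continuous_map_Ad: "continuous_map (topo G) euclidean (\<lambda>g. Ad G g Y)"
proof -
  define N where "N = U0 \<inter> {g \<in> carrier G. inv g \<in> U0}"
  have N: "openin (topo G) N" "N \<subseteq> U0" "\<one> \<in> N" "N \<subseteq> carrier G"
    using one_in_U0 chart_openin[OF id_chart_in]
      openin_continuous_map_preimage[OF inv_continuous chart_openin[OF id_chart_in]]
    unfolding N_def by auto
  have "continuous_map (subtopology (topo G) N) euclidean crd"
    using continuous_map_from_subtopology_mono[OF chart_continuous[OF id_chart_in] N(2)] .
  moreover have "continuous_on (crd ` N) (\<lambda>x. D_conj Y (x, e0))"
  proof (rule continuous_at_imp_continuous_on, rule ballI)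
    fix x assume "x \<in> crd ` N"
    then have "(x, e0) \<in> conj_dom"
      using N(2) by (intro conj_dom_e0) (auto simp: N_def)
    then have "isCont (D_conj Y) (x, e0)"
      by (intro differentiable_imp_continuous_within D_conj_differentiable)
    moreover have "isCont (\<lambda>x. (x, e0)) x" by (intro continuous_intros)
    ultimately show "isCont (\<lambda>x. D_conj Y (x, e0)) x"
      using isCont_o2[of x "\<lambda>x. (x, e0)" "D_conj Y"] by simp
  qed
  ultimately have "continuous_map (subtopology (topo G) N) euclidean ((\<lambda>x. D_conj Y (x, e0)) \<circ> crd)"
    using N(4) by (intro continuous_map_compose[of _ "top_of_set (crd ` N)"])
      (auto simp: continuous_map_in_subtopology)
  then have near_one: "continuous_map (subtopology (topo G) N) euclidean (\<lambda>g. Ad G g Y)"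
  proof (rule continuous_map_eq)
    fix g assume "g \<in> topspace (subtopology (topo G) N)"
    then have "g \<in> U0" "inv g \<in> U0" by (auto simp: N_def)
    then show "((\<lambda>x. D_conj Y (x, e0)) \<circ> crd) g = Ad G g Y"
      using Ad_pt[of "crd g" Y] by simp
  qed
  show ?thesis
    unfolding continuous_map_def
  proof (intro conjI allI impI)
    fix W :: "'e set" assume W: "openin euclidean W"
    show "openin (topo G) {g \<in> topspace (topo G). Ad G g Y \<in> W}"
    proof (subst openin_subopen, intro ballI)
      fix g assume g: "g \<in> {g \<in> topspace (topo G). Ad G g Y \<in> W}"
      then have gc: "g \<in> carrier G" by simp
      have "open (Ad G g -` W)"
        using linear_Ad[OF gc] W by (intro open_vimage linear_continuous_on) (auto simp: linear_conv_bounded_linear)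
      then have "openin (subtopology (topo G) N) {n \<in> topspace (subtopology (topo G) N). Ad G n Y \<in> Ad G g -` W}"
        by (intro openin_continuous_map_preimage[OF near_one]) simp
      then have 1: "openin (topo G) {n \<in> N. Ad G g (Ad G n Y) \<in> W}"
        using N(1,4) by (auto simp: openin_open_subtopology Int_absorb1)
      have "continuous_map (topo G) (topo G) (\<lambda>h. inv g \<otimes> h)"
        using gc by (intro continuous_map_mult) auto
      from openin_continuous_map_preimage[OF this 1]
      have 2: "openin (topo G) {h \<in> carrier G. inv g \<otimes> h \<in> N \<and> Ad G g (Ad G (inv g \<otimes> h) Y) \<in> W}"
        by simp
      show "\<exists>T. openin (topo G) T \<and> g \<in> T \<and> T \<subseteq> {g \<in> topspace (topo G). Ad G g Y \<in> W}"
      proof (intro exI conjI, rule 2)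
        show "g \<in> {h \<in> carrier G. inv g \<otimes> h \<in> N \<and> Ad G g (Ad G (inv g \<otimes> h) Y) \<in> W}"
          using g N(3) by auto
        show "{h \<in> carrier G. inv g \<otimes> h \<in> N \<and> Ad G g (Ad G (inv g \<otimes> h) Y) \<in> W}
           \<subseteq> {g \<in> topspace (topo G). Ad G g Y \<in> W}"
          using gc by (auto simp flip: Ad_mult m_assoc)
      qed
    qed
  qed auto
qed

lemma compact_Ad_image:
  assumes "compact_space (topo G)"
  shows "compact ((\<lambda>g. Ad G g Y) ` carrier G)"
  using image_compactin[OF _ continuous_map_Ad[of Y], of "carrier G"] assms
  by (simp add: compact_space_def)

lemma Ad_bounded:
  assumes "compact_space (topo G)"
  obtains M where "M > 0" "\<And>g v. g \<in> carrier G \<Longrightarrow> norm (Ad G g v) \<le> M * norm v"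
proof -
  have "\<exists>m>0. \<forall>g\<in>carrier G. norm (Ad G g b) \<le> m" for b
    using compact_imp_bounded[OF compact_Ad_image[OF assms, of b]] unfolding bounded_pos by auto
  then obtain m where m: "\<And>b. m b > 0" "\<And>b g. g \<in> carrier G \<Longrightarrow> norm (Ad G g b) \<le> m b"
    by metis
  show ?thesis
  proof
    show "(\<Sum>b\<in>Basis. m b) > (0::real)" using m(1) by (intro sum_pos) auto
    fix g v assume g: "g \<in> carrier G"
    have "Ad G g v = (\<Sum>b\<in>Basis. (v \<bullet> b) *\<^sub>R Ad G g b)"
      by (rule linear_Basis_expansion[OF linear_Ad[OF g]])
    also have "norm \<dots> \<le> (\<Sum>b\<in>Basis. m b * norm v)"
    proof (rule sum_norm_le)
      fix b :: 'e assume b: "b \<in> Basis"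
      have "\<bar>v \<bullet> b\<bar> * norm (Ad G g b) \<le> norm v * m b"
        using b m g by (intro mult_mono Basis_le_norm) auto
      then show "norm ((v \<bullet> b) *\<^sub>R Ad G g b) \<le> m b * norm v" by (simp add: mult.commute)
    qed
    finally show "norm (Ad G g v) \<le> (\<Sum>b\<in>Basis. m b) * norm v" by (simp add: sum_distrib_right)
  qed
qed

text \<open>Expresses that the adjoint group is closed. The total deviation from \<open>T\<close> on
  \<open>E\<close> is continuous in \<open>g\<close> and attains its minimum on the compact group;
  it tends to 0 along the sequence, so the minimum is 0. No convergent subsequence has to be
  extracted.\<close>

lemma Ad_limit_attained:
  assumes "compact_space (topo G)" "finite E"
    and g: "eventually (\<lambda>n. g n \<in> carrier G) sequentially"
    and lim: "\<And>b. b \<in> E \<Longrightarrow> (\<lambda>n. Ad G (g n) b) \<longlonglongrightarrow> T b"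
  shows "\<exists>g\<in>carrier G. \<forall>b\<in>E. Ad G g b = T b"
proof -
  define f where "f g = (\<Sum>b\<in>E. norm (Ad G g b - T b))" for g
  have "continuous_map (topo G) euclideanreal f"
    unfolding f_def using \<open>finite E\<close>
    by (intro continuous_map_sum continuous_map_norm continuous_map_diff continuous_map_Ad) auto
  from image_compactin[OF _ this, of "carrier G"] have "compact (f ` carrier G)"
    using assms(1) by (simp add: compact_space_def)
  then obtain g0 where g0: "g0 \<in> carrier G" "\<And>g. g \<in> carrier G \<Longrightarrow> f g0 \<le> f g"
    using compact_attains_inf[of "f ` carrier G"] by fastforce
  have "(\<lambda>n. f (g n)) \<longlonglongrightarrow> (\<Sum>b\<in>E. norm (T b - T b))"
    unfolding f_def by (intro tendsto_intros lim)
  then have "f g0 \<le> 0"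
    by (intro tendsto_lowerbound[of "\<lambda>n. f (g n)" 0 sequentially])
      (use g g0 in \<open>auto elim: eventually_mono\<close>)
  then have "(\<Sum>b\<in>E. norm (Ad G g0 b - T b)) = 0"
    unfolding f_def by (intro antisym sum_nonneg) auto
  then have "\<forall>b\<in>E. Ad G g0 b = T b"
    using \<open>finite E\<close> by (simp add: sum_nonneg_eq_0_iff)
  then show ?thesis using g0 by blast
qed

text \<open>The curves \<open>r b\<close> are the orbits \<open>exp (t ad X) b\<close>, so the claim
  says that \<open>exp (t ad X)\<close> agrees with some \<open>Ad g\<close> on \<open>E\<close>.
  The element \<open>g\<close> comes from powers of group elements close to the identity, via the
  Euler scheme and compactness.\<close>

lemma Ad_flow_attained:
  assumes "compact_space (topo G)" "finite E" "t > 0"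
    and r: "\<And>b s. b \<in> E \<Longrightarrow> (r b has_vector_derivative bracket G X (r b s)) (at s)"
    and r0: "\<And>b. b \<in> E \<Longrightarrow> r b 0 = b"
  shows "\<exists>g\<in>carrier G. \<forall>b\<in>E. Ad G g b = r b t"
proof -
  \<comment> \<open>A straight line in the chart. It need not be a one-parameter subgroup; only its
    velocity \<open>X\<close> at the identity matters.\<close>
  define p where "p h = pt (e0 + h *\<^sub>R X)" for h
  obtain M where M: "M > 0" "\<And>g v. g \<in> carrier G \<Longrightarrow> norm (Ad G g v) \<le> M * norm v"
    using Ad_bounded[OF assms(1)] by blast
  have pow: "(Ad G g ^^ k) v = Ad G (g [^] k) v" if "g \<in> carrier G" for g k v
  proof (induction k)
    \<comment> \<open>Powers of \<open>Ad g\<close> are again of the form \<open>Ad\<close> of a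
      group element, so the single bound \<open>M\<close> serves all of them. This is the stability
      the scheme requires.\<close>
    case (Suc k)
    have "Ad G (g [^] Suc k) v = Ad G (g \<otimes> g [^] k) v"
      using that by (simp only: nat_pow_Suc2)
    then show ?case using Suc that by (simp add: Ad_mult del: nat_pow_Suc)
  qed simp
  have lim0: "((\<lambda>h. e0 + h *\<^sub>R X) \<longlongrightarrow> e0) (at_right 0)"
    by (auto intro!: tendsto_eq_intros)
  have ev: "eventually (\<lambda>h. p h \<in> carrier G) (at_right 0)"
    using topological_tendstoD[OF lim0 open_O0 e0_in]
    unfolding p_def by (rule eventually_mono) (rule pt_carrier)
  have der: "((\<lambda>h. Ad G (p h) v) has_vector_derivative bracket G X v) (at 0)" for v
  proof -
    have "((\<lambda>h::real. e0 + h *\<^sub>R X) has_derivative (\<lambda>h. h *\<^sub>R X)) (at 0)"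
      by (auto intro!: derivative_eq_intros)
    from has_derivative_compose[OF this, of "\<lambda>x. Ad G (pt x) v" "\<lambda>X. bracket G X v"] Ad_pt_derivative[of v]
    show ?thesis
      unfolding has_vector_derivative_def p_def by (simp add: linear_scale[OF linear_bracket_left])
  qed
  define q where "q n = p (t / real (Suc n)) [^] Suc n" for n
  show ?thesis
  proof (rule Ad_limit_attained[OF assms(1,2)])
    have "filterlim (\<lambda>n. t / real (Suc n)) (at_right 0) sequentially"
      using \<open>t > 0\<close> by (rule filterlim_over_Suc)
    from eventually_compose_filterlim[OF ev this]
    have evn: "eventually (\<lambda>n. p (t / real (Suc n)) \<in> carrier G) sequentially" .
    then show "eventually (\<lambda>n. q n \<in> carrier G) sequentially"
      unfolding q_def by (rule eventually_mono) (rule nat_pow_closed)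
    fix b assume b: "b \<in> E"
    have "(\<lambda>n. (Ad G (p (t / real (Suc n))) ^^ Suc n) (r b 0)) \<longlonglongrightarrow> r b t"
    proof (rule euler_scheme_converges[where A = "\<lambda>h. Ad G (p h)", OF _ linear_bracket_right _ der r[OF b] \<open>t > 0\<close> M(1)])
      show "eventually (\<lambda>h. linear (Ad G (p h)) \<and> (\<forall>k v. norm ((Ad G (p h) ^^ k) v) \<le> M * norm v)) (at_right 0)"
        using ev by (rule eventually_mono) (simp add: pow linear_Ad M)
      show "Ad G (p 0) v = v" for v by (simp add: p_def)
    qed
    then show "(\<lambda>n. Ad G (q n) b) \<longlonglongrightarrow> r b t"
      by (rule Lim_transform_eventually)
        (use evn in eventually_elim, simp only: pow r0[OF b] q_def)
  qed
qed

end

subsection \<open>Restricted roots and the Weyl group\<close>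

context lie_grp
begin

text \<open>Conjugating the one-parameter subgroup of \<open>2 pi H\<close> by \<open>g\<close>
  gives one with velocity \<open>2 pi Ad g H\<close>, and conjugation fixes its value
  \<open>\<one>\<close> at time 1.\<close>

lemma unit_lattice_Ad:
  assumes H: "H \<in> unit_lattice G \<aa>" and g: "g \<in> carrier G" and a: "Ad G g H \<in> \<aa>"
  shows "Ad G g H \<in> unit_lattice G \<aa>"
proof -
  from H obtain \<gamma> where \<gamma>: "one_parameter_subgroup G ((2 * pi) *\<^sub>R H) \<gamma>" "\<gamma> 1 = \<one>"
    unfolding unit_lattice_def is_lie_exp_def by auto
  then have c: "continuous_map euclideanreal (topo G) \<gamma>" and m: "\<And>s t. \<gamma> (s + t) = \<gamma> s \<otimes> \<gamma> t"
    and d: "((crd \<circ> \<gamma>) has_vector_derivative (2 * pi) *\<^sub>R H) (at 0)"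
    unfolding one_parameter_subgroup_def by auto
  have car: "\<gamma> t \<in> carrier G" for t
    using continuous_map_image_subset_topspace[OF c] by auto
  have \<gamma>0: "\<gamma> 0 = \<one>" using m[of 0 0] car[of 0] by (simp add: l_cancel_one)
  have tg: "tangential (cj g)" by (rule tangential_conj[OF g])
  have "one_parameter_subgroup G ((2 * pi) *\<^sub>R Ad G g H) (cj g \<circ> \<gamma>)"
    unfolding one_parameter_subgroup_def
  proof (intro conjI allI)
    show "continuous_map euclideanreal (topo G) (cj g \<circ> \<gamma>)"
      using c tg by (auto simp: tangential_def intro: continuous_map_compose)
    show "(cj g \<circ> \<gamma>) (s + t) = (cj g \<circ> \<gamma>) s \<otimes> (cj g \<circ> \<gamma>) t" for s t
      using hom_mult[OF hom_conj[OF g] car car] by (simp add: m)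
    show "((crd \<circ> (cj g \<circ> \<gamma>)) has_vector_derivative (2 * pi) *\<^sub>R Ad G g H) (at 0)"
      using tangent_map_curve[OF tg c \<gamma>0 d] linear_scale[OF linear_Ad[OF g]] by (simp add: Ad_def)
  qed
  moreover have "(cj g \<circ> \<gamma>) 1 = \<one>" using \<gamma>(2) g by simp
  ultimately show ?thesis using a unfolding unit_lattice_def is_lie_exp_def by blast
qed

lemma tangent_map_involution:
  assumes f: "tangential f" and inv: "\<And>g. g \<in> carrier G \<Longrightarrow> f (f g) = g"
  shows "tangent_map G f (tangent_map G f X) = X"
proof -
  have "tangent_map G id = tangent_map G f \<circ> tangent_map G f"
    using inv by (intro tangent_map_compose f) auto
  with tangent_map_id[of id] show ?thesis by (simp add: fun_eq_iff)
qed

lemma tangential_symmetric_pair: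
  assumes "symmetric_pair G K \<sigma>"
  shows "tangential \<sigma>"
proof -
  have \<sigma>: "smooth_self_map G \<sigma>" "\<sigma> \<in> hom G G" using assms by (auto simp: symmetric_pair_def)
  have 1: "\<sigma> \<one> = \<one>" by (rule hom_one[OF \<sigma>(2) is_group is_group])
  have "(crd \<circ> \<sigma> \<circ> inv_into U0 crd) differentiable at (crd \<one>)"
    using one_in_U0 1 id_chart_in by (intro smooth_self_map_differentiable \<sigma>) auto
  then show ?thesis
    using \<sigma>(1) 1 unfolding tangential_def by (simp add: smooth_self_map_def of_coord_def)
qed

end

section \<open>The infinitesimal involution and restricted root vectors\<close>

locale symmetric_setup = lie_grp G for G :: "('g, 'e::euclidean_space) lie_group" (structure) +
  fixes K :: "'g set" and \<sigma> :: "'g \<Rightarrow> 'g" and B :: "'e \<Rightarrow> 'e \<Rightarrow> real" and \<aa> :: "'e set"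
  assumes sym: "symmetric_pair G K \<sigma>"
    and B_inner: "Ad_invariant_inner_product G B"
    and max_abelian: "maximal_abelian_in G (p_space G \<sigma>) \<aa>"
begin

abbreviation "\<theta> \<equiv> tangent_map G \<sigma>"

lemma tangential_\<sigma>: "tangential \<sigma>"
  by (rule tangential_symmetric_pair[OF sym])

lemma linear_\<theta>: "linear \<theta>"
  by (rule linear_tangent_map[OF tangential_\<sigma>])

lemma \<theta>_\<theta> [simp]: "\<theta> (\<theta> X) = X"
  using sym by (intro tangent_map_involution tangential_\<sigma>) (simp add: symmetric_pair_def)

lemma \<theta>_bracket: "\<theta> (bracket G X Y) = bracket G (\<theta> X) (\<theta> Y)"
  using sym by (intro tangent_map_bracket tangential_\<sigma>) (simp add: symmetric_pair_def)

lemma \<theta>_\<aa>: "H \<in> \<aa> \<Longrightarrow> \<theta> H = - H"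
  using max_abelian by (auto simp: maximal_abelian_in_def p_space_def)

lemma subspace_\<aa>: "subspace \<aa>"
  and abelian: "H \<in> \<aa> \<Longrightarrow> H' \<in> \<aa> \<Longrightarrow> bracket G H H' = 0"
  using max_abelian by (auto simp: maximal_abelian_in_def abelian_subspace_def)

lemma bilinear_B: "bilinear B" and B_sym: "B X Y = B Y X" and B_pos: "X \<noteq> 0 \<Longrightarrow> B X X > 0"
  using B_inner by (auto simp: Ad_invariant_inner_product_def)

lemmas B_simps = bilinear_ladd[OF bilinear_B] bilinear_radd[OF bilinear_B]
  bilinear_lsub[OF bilinear_B] bilinear_rsub[OF bilinear_B]
  bilinear_lmul[OF bilinear_B] bilinear_rmul[OF bilinear_B]
  bilinear_lneg[OF bilinear_B] bilinear_rneg[OF bilinear_B]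
  bilinear_lzero[OF bilinear_B] bilinear_rzero[OF bilinear_B]

lemmas bracket_simps = bilinear_ladd[OF bilinear_bracket] bilinear_radd[OF bilinear_bracket]
  bilinear_lsub[OF bilinear_bracket] bilinear_rsub[OF bilinear_bracket]
  bilinear_lmul[OF bilinear_bracket] bilinear_rmul[OF bilinear_bracket]
  bilinear_lneg[OF bilinear_bracket] bilinear_rneg[OF bilinear_bracket]
  bilinear_lzero[OF bilinear_bracket] bilinear_rzero[OF bilinear_bracket]

text \<open>Adjoining \<open>Z\<close> to \<open>\<aa>\<close> gives an abelian subspace that is
  still contained in the (-1)-eigenspace of \<theta>; maximality of \<open>\<aa>\<close> forces it
  to be \<open>\<aa>\<close> itself.\<close>

lemma centralizer_in_p:
  assumes "\<theta> Z = - Z" "\<And>H. H \<in> \<aa> \<Longrightarrow> bracket G H Z = 0"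
  shows "Z \<in> \<aa>"
proof -
  have mem: "\<exists>k. \<exists>H\<in>\<aa>. x = H + k *\<^sub>R Z" if x: "x \<in> span (insert Z \<aa>)" for x
  proof -
    obtain k where "x - k *\<^sub>R Z \<in> span \<aa>"
      using x unfolding span_breakdown_eq by blast
    then have "x - k *\<^sub>R Z \<in> \<aa>" using subspace_\<aa> by (simp add: span_eq_iff[THEN iffD2])
    then show ?thesis by (metis diff_add_cancel)
  qed
  have "bracket G x y = 0" if xy: "x \<in> span (insert Z \<aa>)" "y \<in> span (insert Z \<aa>)" for x y
  proof -
    obtain k H l H' where "x = H + k *\<^sub>R Z" "y = H' + l *\<^sub>R Z" "H \<in> \<aa>" "H' \<in> \<aa>"
      using mem[OF xy(1)] mem[OF xy(2)] by blast
    then show ?thesis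
      using assms(2) abelian bracket_antisym[of Z H'] by (simp add: bracket_simps bracket_self)
  qed
  moreover have "span (insert Z \<aa>) \<subseteq> p_space G \<sigma>"
  proof (rule span_minimal)
    show "subspace (p_space G \<sigma>)"
      unfolding p_space_def subspace_def
      by (auto simp: linear_add[OF linear_\<theta>] linear_scale[OF linear_\<theta>] linear_0[OF linear_\<theta>])
    show "insert Z \<aa> \<subseteq> p_space G \<sigma>"
      using assms(1) \<theta>_\<aa> by (auto simp: p_space_def)
  qed
  ultimately have "span (insert Z \<aa>) = \<aa>"
    using max_abelian span_superset[of "insert Z \<aa>"]
    unfolding maximal_abelian_in_def abelian_subspace_def by (metis insert_subset subspace_span)
  then show ?thesis using span_superset[of "insert Z \<aa>"] by blast
qed

text \<open>If \<open>X0 + i Y0\<close> is a root vector, so is \<theta> applied to its conjugate,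
  because \<theta> is -1 on \<open>\<aa>\<close>. Hence the root space is stable under the real
  involution sending \<open>(X0, Y0)\<close> to \<open>(\<theta> X0, - \<theta> Y0)\<close>, and a
  fixed nonzero vector of this involution is sought.\<close>

lemma root_vectors:
  assumes "\<alpha> \<in> restricted_roots G B \<aa>"
  obtains X Y where "\<theta> X = X" "\<theta> Y = - Y" "Y \<noteq> 0"
    "\<And>H. H \<in> \<aa> \<Longrightarrow> bracket G H X = - B \<alpha> H *\<^sub>R Y" "\<And>H. H \<in> \<aa> \<Longrightarrow> bracket G H Y = B \<alpha> H *\<^sub>R X"
proof -
  note obt = that
  have \<alpha>: "\<alpha> \<in> \<aa>" "\<alpha> \<noteq> 0" and ne: "root_space G B \<aa> \<alpha> \<noteq> {0}"
    using assms by (auto simp: restricted_roots_def)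
  have "0 \<in> root_space G B \<aa> \<alpha>"
    by (simp add: root_space_def zero_prod_def bracket_simps)
  with ne have "\<exists>p\<in>root_space G B \<aa> \<alpha>. p \<noteq> 0" by auto
  then obtain X0 Y0 where XY: "(X0, Y0) \<in> root_space G B \<aa> \<alpha>" "(X0, Y0) \<noteq> 0"
    by (metis surj_pair)
  have r: "bracket G H X0 = - B \<alpha> H *\<^sub>R Y0" "bracket G H Y0 = B \<alpha> H *\<^sub>R X0" if "H \<in> \<aa>" for H
    using XY(1) that by (auto simp: root_space_def)
  have r': "bracket G H (\<theta> X0) = B \<alpha> H *\<^sub>R \<theta> Y0" "bracket G H (\<theta> Y0) = - B \<alpha> H *\<^sub>R \<theta> X0" if "H \<in> \<aa>" for H
  proof -
    have "bracket G H (\<theta> Z) = - \<theta> (bracket G H Z)" for Z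
      using \<theta>_bracket[of H Z] \<theta>_\<aa>[OF that] by (simp add: bracket_simps)
    then show "bracket G H (\<theta> X0) = B \<alpha> H *\<^sub>R \<theta> Y0" "bracket G H (\<theta> Y0) = - B \<alpha> H *\<^sub>R \<theta> X0"
      using r[OF that] by (simp_all add: linear_scale[OF linear_\<theta>] linear_neg[OF linear_\<theta>])
  qed
  have *: thesis if "\<theta> X = X" "\<theta> Y = - Y" "X \<noteq> 0 \<or> Y \<noteq> 0"
    "\<And>H. H \<in> \<aa> \<Longrightarrow> bracket G H X = - B \<alpha> H *\<^sub>R Y" "\<And>H. H \<in> \<aa> \<Longrightarrow> bracket G H Y = B \<alpha> H *\<^sub>R X" for X Y
  proof -
    \<comment> \<open>Taking \<open>H = \<alpha>\<close> in the second root equation recovers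
      \<open>X\<close> from \<open>Y\<close> up to the positive factor
      \<open>B \<alpha> \<alpha>\<close>, so \<open>Y = 0\<close> would force
      \<open>X = 0\<close>.\<close>
    have "Y \<noteq> 0"
      using that(3) that(5)[OF \<alpha>(1)] B_pos[OF \<alpha>(2)] by (auto simp: bracket_simps)
    then show thesis using obt[OF that(1,2) _ that(4,5)] by simp
  qed
  show thesis
  proof (cases "X0 + \<theta> X0 = 0 \<and> Y0 - \<theta> Y0 = 0")
    case False
    then show ?thesis
      by (intro *[of "X0 + \<theta> X0" "Y0 - \<theta> Y0"])
        (auto simp: linear_add[OF linear_\<theta>] linear_diff[OF linear_\<theta>] bracket_simps r r' algebra_simps)
  next
    case True
    then have "X0 - \<theta> X0 = 2 *\<^sub>R X0" "Y0 + \<theta> Y0 = 2 *\<^sub>R Y0"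
      by (auto simp: scaleR_2 add_eq_0_iff)
    then have "- (Y0 + \<theta> Y0) \<noteq> 0 \<or> X0 - \<theta> X0 \<noteq> 0"
      using XY(2) by (auto simp: zero_prod_def)
    then show ?thesis
      \<comment> \<open>When the symmetrization vanishes, the vector is anti-fixed by the
        involution. Multiplication by \<open>i\<close> sends \<open>(X, Y)\<close> to
        \<open>(- Y, X)\<close> and turns anti-fixed vectors into fixed ones.\<close>
      by (intro *[of "- (Y0 + \<theta> Y0)" "X0 - \<theta> X0"])
        (auto simp: linear_add[OF linear_\<theta>] linear_diff[OF linear_\<theta>] linear_neg[OF linear_\<theta>] bracket_simps r r' algebra_simps)
  qed
qed

lemma linear_reflection: "linear (\<lambda>H. H - (2 * B \<alpha> H / B \<alpha> \<alpha>) *\<^sub>R \<alpha>)"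
  by (rule linearI) (auto simp: B_simps algebra_simps add_divide_distrib)

text \<open>In the plane of \<alpha> and \<open>Y\<close> the flow of \<open>ad X\<close> is a
  rotation up to rescaling the axes, and it fixes the orthogonal complement of \<alpha> in
  \<open>\<aa>\<close>. At half a period it reverses \<alpha>.\<close>

lemma reflection_is_Ad:
  assumes "compact_space (topo G)" and root: "\<alpha> \<in> restricted_roots G B \<aa>"
  shows "\<exists>g\<in>carrier G. \<forall>H\<in>\<aa>. Ad G g H = root_reflection B \<aa> \<alpha> H"
proof -
  have \<alpha>: "\<alpha> \<in> \<aa>" "\<alpha> \<noteq> 0" using root by (auto simp: restricted_roots_def)
  obtain X Y where XY: "\<theta> X = X" "\<theta> Y = - Y" "Y \<noteq> 0"
    "\<And>H. H \<in> \<aa> \<Longrightarrow> bracket G H X = - B \<alpha> H *\<^sub>R Y" "\<And>H. H \<in> \<aa> \<Longrightarrow> bracket G H Y = B \<alpha> H *\<^sub>R X"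
    using root_vectors[OF root] by metis
  have XH: "bracket G X H = B \<alpha> H *\<^sub>R Y" if "H \<in> \<aa>" for H
    using bracket_antisym[of X H] XY(4)[OF that] by simp
  have Za: "bracket G X Y \<in> \<aa>"
  proof (rule centralizer_in_p)
    show "\<theta> (bracket G X Y) = - bracket G X Y"
      using XY by (simp add: \<theta>_bracket bracket_simps)
    show "bracket G H (bracket G X Y) = 0" if "H \<in> \<aa>" for H
      using jacobi[of H X Y] XY(4,5)[OF that] by (simp add: bracket_simps bracket_self)
  qed
  \<comment> \<open>Membership in \<open>\<aa>\<close> lets the bracket be identified by pairing
    with \<open>\<aa>\<close> alone: skewness gives
    \<open>B [X,Y] H = - B Y [X,H] = - B \<alpha> H * B Y Y\<close>.\<close>
  have XY': "bracket G X Y = - B Y Y *\<^sub>R \<alpha>"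
  proof -
    let ?W = "bracket G X Y + B Y Y *\<^sub>R \<alpha>"
    have W: "?W \<in> \<aa>"
      using Za \<alpha>(1) subspace_\<aa> by (simp add: subspace_add subspace_scale)
    have "B ?W H = 0" if "H \<in> \<aa>" for H
      using bracket_skew[OF B_inner, of X Y H] XH[OF that] by (simp add: B_simps)
    then have "?W = 0" using B_pos W by force
    then show ?thesis by (simp add: eq_neg_iff_add_eq_0)
  qed
  \<comment> \<open>The angular frequency: \<open>ad X\<close> squared multiplies both \<alpha> and
    \<open>Y\<close> by \<open>- \<omega>^2\<close>.\<close>
  define \<omega> where "\<omega> = sqrt (B \<alpha> \<alpha> * B Y Y)"
  have pos: "B \<alpha> \<alpha> > 0" "B Y Y > 0" using \<alpha> XY B_pos by auto
  then have \<omega>: "\<omega> > 0" "\<omega> * \<omega> = B \<alpha> \<alpha> * B Y Y" by (auto simp: \<omega>_def)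
  then have \<omega>': "B Y Y / \<omega> = \<omega> / B \<alpha> \<alpha>" using pos by (simp add: field_simps)
  \<comment> \<open>The explicit solution of \<open>r' = [X, r]\<close> starting at
    \<open>H\<close>. Only the \<alpha>-component of \<open>H\<close> turns, towards
    \<open>Y\<close>; at time \<open>pi / \<omega>\<close> the cosine is -1 and the sine 0, which
    leaves the reflection of \<open>H\<close>.\<close>
  define r where "r H s = H + (B \<alpha> H / B \<alpha> \<alpha> * (cos (\<omega> * s) - 1)) *\<^sub>R \<alpha> + (B \<alpha> H / \<omega> * sin (\<omega> * s)) *\<^sub>R Y" for H s
  have r: "(r H has_vector_derivative bracket G X (r H s)) (at s)" if "H \<in> \<aa>" for H s
  proof -
    have "(r H has_vector_derivative (B \<alpha> H / B \<alpha> \<alpha> * (- sin (\<omega> * s) * \<omega>)) *\<^sub>R \<alpha>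
        + (B \<alpha> H / \<omega> * (cos (\<omega> * s) * \<omega>)) *\<^sub>R Y) (at s)"
      unfolding r_def using pos \<omega>(1) by (auto intro!: derivative_eq_intros simp: mult_ac)
    also have "(B \<alpha> H / B \<alpha> \<alpha> * (- sin (\<omega> * s) * \<omega>)) *\<^sub>R \<alpha> + (B \<alpha> H / \<omega> * (cos (\<omega> * s) * \<omega>)) *\<^sub>R Y
       = bracket G X (r H s)"
    proof -
      have "bracket G X (r H s) = (B \<alpha> H + B \<alpha> H / B \<alpha> \<alpha> * (cos (\<omega> * s) - 1) * B \<alpha> \<alpha>) *\<^sub>R Y
         - (B \<alpha> H * sin (\<omega> * s) * (B Y Y / \<omega>)) *\<^sub>R \<alpha>"
        unfolding r_def by (simp add: bracket_simps XH that \<alpha> XY' algebra_simps)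
      moreover have "B \<alpha> H + B \<alpha> H / B \<alpha> \<alpha> * (cos (\<omega> * s) - 1) * B \<alpha> \<alpha> = B \<alpha> H * cos (\<omega> * s)"
        using pos by (simp add: field_simps)
      ultimately show ?thesis
        using \<omega>(1) unfolding \<omega>' by simp
    qed
    finally show ?thesis .
  qed
  \<comment> \<open>The limit argument handles finitely many vectors; a basis of
    \<open>\<aa>\<close> suffices, since \<open>Ad g\<close> and the reflection are both
    linear.\<close>
  obtain E where E: "E \<subseteq> \<aa>" "independent E" "\<aa> \<subseteq> span E"
    using basis_exists[of \<aa>] by metis
  have "\<exists>g\<in>carrier G. \<forall>b\<in>E. Ad G g b = r b (pi / \<omega>)"
  proof (rule Ad_flow_attained[OF assms(1) independent_imp_finite[OF E(2)], where X = X])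
    show "0 < pi / \<omega>" using \<omega>(1) by simp
    show "(r b has_vector_derivative bracket G X (r b s)) (at s)" if "b \<in> E" for b s
      using r E(1) that by blast
    show "r b 0 = b" for b by (simp add: r_def)
  qed
  then obtain g where g: "g \<in> carrier G" "\<And>b. b \<in> E \<Longrightarrow> Ad G g b = r b (pi / \<omega>)" by blast
  have rH: "r H (pi / \<omega>) = H - (2 * B \<alpha> H / B \<alpha> \<alpha>) *\<^sub>R \<alpha>" for H
    using \<omega>(1) by (simp add: r_def algebra_simps)
  have "Ad G g H = H - (2 * B \<alpha> H / B \<alpha> \<alpha>) *\<^sub>R \<alpha>" if "H \<in> \<aa>" for H
    by (rule linear_eq_on[OF linear_Ad[OF g(1)] linear_reflection, of H E]) (use that E g(2) rH in auto)
  then show ?thesis using g(1) by (auto simp: root_reflection_def)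
qed

section \<open>Action of the Weyl group on the dual lattice and on the shifted sphere\<close>

lemma root_reflection_orth_group:
  assumes "\<alpha> \<in> \<aa>" "\<alpha> \<noteq> 0"
  shows "root_reflection B \<aa> \<alpha> \<in> orth_group B \<aa>"
proof -
  have "B \<alpha> \<alpha> \<noteq> 0" using B_pos assms(2) by force
  have "B (x - (2 * B \<alpha> x / B \<alpha> \<alpha>) *\<^sub>R \<alpha>) (y - (2 * B \<alpha> y / B \<alpha> \<alpha>) *\<^sub>R \<alpha>) = B x y" for x y
    using \<open>B \<alpha> \<alpha> \<noteq> 0\<close> by (simp add: B_simps B_sym[of x \<alpha>] right_diff_distrib)
  moreover have "x - (2 * B \<alpha> x / B \<alpha> \<alpha>) *\<^sub>R \<alpha> \<in> \<aa>" if "x \<in> \<aa>" for x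
    using that assms(1) subspace_\<aa> by (simp add: subspace_diff subspace_scale)
  ultimately show ?thesis
    unfolding orth_group_def root_reflection_def
    using linear_add[OF linear_reflection] linear_scale[OF linear_reflection]
      subspace_add[OF subspace_\<aa>] subspace_scale[OF subspace_\<aa>]
    by (auto simp del: scaleR_scaleR)
qed

lemma root_reflection_involution:
  assumes "\<alpha> \<in> \<aa>" "\<alpha> \<noteq> 0" "H \<in> \<aa>"
  shows "root_reflection B \<aa> \<alpha> (root_reflection B \<aa> \<alpha> H) = H"
proof -
  have "B \<alpha> \<alpha> \<noteq> 0" using B_pos assms(2) by force
  moreover have "H - (2 * B \<alpha> H / B \<alpha> \<alpha>) *\<^sub>R \<alpha> \<in> \<aa>"
    using assms subspace_\<aa> by (simp add: subspace_diff subspace_scale)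
  ultimately show ?thesis
    using assms by (simp add: root_reflection_def B_simps flip: scaleR_add_left)
qed

lemma orth_groupD:
  assumes "w \<in> orth_group B \<aa>"
  shows "x \<in> \<aa> \<Longrightarrow> w x \<in> \<aa>" "x \<in> \<aa> \<Longrightarrow> y \<in> \<aa> \<Longrightarrow> B (w x) (w y) = B x y"
  using assms by (auto simp: orth_group_def)

lemma compose_orth_group:
  assumes "f \<in> orth_group B \<aa>" "h \<in> orth_group B \<aa>"
  shows "compose \<aa> f h \<in> orth_group B \<aa>"
  using assms orth_groupD(1)[OF assms(2)] subspace_add[OF subspace_\<aa>] subspace_scale[OF subspace_\<aa>]
  unfolding orth_group_def by (simp add: compose_def PiE_iff)

lemma root_reflection_Bij:
  assumes "\<alpha> \<in> \<aa>" "\<alpha> \<noteq> 0"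
  shows "root_reflection B \<aa> \<alpha> \<in> Bij \<aa>"
proof -
  have "bij_betw (root_reflection B \<aa> \<alpha>) \<aa> \<aa>"
    using root_reflection_involution[OF assms] orth_groupD(1)[OF root_reflection_orth_group[OF assms]]
    by (intro bij_betw_byWitness[where f' = "root_reflection B \<aa> \<alpha>"]) auto
  then show ?thesis by (simp add: Bij_def root_reflection_def)
qed

text \<open>The reflection preserves the unit lattice because it is the restriction of some
  \<open>Ad g\<close>. As an isometric involution it is self-adjoint for \<open>B\<close>, so it can
  be moved to the other side of the pairing.\<close>

lemma root_reflection_dual_lattice:
  assumes "compact_space (topo G)" and root: "\<alpha> \<in> restricted_roots G B \<aa>"
    and \<mu>: "\<mu> \<in> dual_lattice B \<aa> (unit_lattice G \<aa>)"
  shows "root_reflection B \<aa> \<alpha> \<mu> \<in> dual_lattice B \<aa> (unit_lattice G \<aa>)"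
proof -
  let ?s = "root_reflection B \<aa> \<alpha>"
  have \<alpha>: "\<alpha> \<in> \<aa>" "\<alpha> \<noteq> 0" using root by (auto simp: restricted_roots_def)
  note s = orth_groupD[OF root_reflection_orth_group[OF \<alpha>]]
  have \<mu>a: "\<mu> \<in> \<aa>" using \<mu> by (simp add: dual_lattice_def)
  obtain g where g: "g \<in> carrier G" "\<And>H. H \<in> \<aa> \<Longrightarrow> Ad G g H = ?s H"
    using reflection_is_Ad[OF assms(1) root] by blast
  have "B (?s \<mu>) H \<in> \<int>" if H: "H \<in> unit_lattice G \<aa>" for H
  proof -
    have Ha: "H \<in> \<aa>" using H by (simp add: unit_lattice_def)
    have "?s H \<in> unit_lattice G \<aa>"
      using unit_lattice_Ad[OF H g(1)] g(2)[OF Ha] s(1)[OF Ha] by simp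
    then have "B \<mu> (?s H) \<in> \<int>" using \<mu> by (simp add: dual_lattice_def)
    moreover have "B (?s \<mu>) H = B \<mu> (?s H)"
      using s(2)[OF \<mu>a s(1)[OF Ha]] root_reflection_involution[OF \<alpha> Ha] by simp
    ultimately show ?thesis by simp
  qed
  then show ?thesis using s(1)[OF \<mu>a] by (simp add: dual_lattice_def)
qed

text \<open>Both properties hold for the generating reflections and pass to products. The two are
  proved together by one induction over \<open>generate\<close>, whose inverse case is harmless
  because each generator is its own inverse.\<close>

lemma weyl_group_invariance:
  assumes "compact_space (topo G)" and "w \<in> weyl_group B \<aa> (restricted_roots G B \<aa>)"
  shows "w \<in> orth_group B \<aa> \<and>
    w ` dual_lattice B \<aa> (unit_lattice G \<aa>) \<subseteq> dual_lattice B \<aa> (unit_lattice G \<aa>)"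
proof -
  let ?R = "root_reflection B \<aa> ` restricted_roots G B \<aa>"
  let ?\<Gamma> = "dual_lattice B \<aa> (unit_lattice G \<aa>)"
  interpret W: group "BijGroup \<aa>" by (rule group_BijGroup)
  have roots: "\<alpha> \<in> \<aa>" "\<alpha> \<noteq> 0" if "\<alpha> \<in> restricted_roots G B \<aa>" for \<alpha>
    using that by (auto simp: restricted_roots_def)
  have R: "?R \<subseteq> carrier (BijGroup \<aa>)"
    using root_reflection_Bij roots by (auto simp: BijGroup_def)
  have refl: "w \<in> orth_group B \<aa> \<and> w ` ?\<Gamma> \<subseteq> ?\<Gamma>" if "w \<in> ?R" for w
    using that root_reflection_orth_group root_reflection_dual_lattice[OF assms(1)] roots by auto
  show ?thesis
    using assms(2) unfolding weyl_group_def
  proof (induction rule: generate.induct)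
    case one
    then show ?case by (auto simp: BijGroup_def orth_group_def dual_lattice_def subspace_add[OF subspace_\<aa>] subspace_scale[OF subspace_\<aa>])
  next
    case (incl h)
    then show ?case by (rule refl)
  next
    case (inv h)
    then obtain \<alpha> where \<alpha>: "\<alpha> \<in> restricted_roots G B \<aa>" "h = root_reflection B \<aa> \<alpha>" by blast
    have h: "h \<in> Bij \<aa>" using root_reflection_Bij roots \<alpha> by blast
    have "h \<otimes>\<^bsub>BijGroup \<aa>\<^esub> h = \<one>\<^bsub>BijGroup \<aa>\<^esub>"
      using h root_reflection_involution roots \<alpha> by (auto simp: BijGroup_def compose_def)
    then have inv_h: "inv\<^bsub>BijGroup \<aa>\<^esub> h = h"
      using h by (intro W.inv_equality) (auto simp: BijGroup_def)
    show ?case unfolding inv_h by (rule refl[OF inv])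
  next
    case (eng h1 h2)
    have Bij: "h1 \<in> Bij \<aa>" "h2 \<in> Bij \<aa>"
      using W.generate_in_carrier[OF R eng(1)] W.generate_in_carrier[OF R eng(2)]
      by (simp_all add: BijGroup_def)
    have eq: "h1 \<otimes>\<^bsub>BijGroup \<aa>\<^esub> h2 = compose \<aa> h1 h2"
      using Bij by (simp add: BijGroup_def)
    have o: "h1 \<in> orth_group B \<aa>" "h2 \<in> orth_group B \<aa>" and \<Gamma>: "h1 ` ?\<Gamma> \<subseteq> ?\<Gamma>" "h2 ` ?\<Gamma> \<subseteq> ?\<Gamma>"
      using eng(3,4) by blast+
    \<comment> \<open>The group law of \<open>BijGroup\<close> is \<open>compose\<close>, which
      agrees with ordinary composition only on \<open>\<aa>\<close>; the lattice lies
      inside.\<close>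
    have "?\<Gamma> \<subseteq> \<aa>" by (auto simp: dual_lattice_def)
    then have "compose \<aa> h1 h2 x = h1 (h2 x)" if "x \<in> ?\<Gamma>" for x
      using that by (simp add: compose_def subset_iff)
    then have "compose \<aa> h1 h2 ` ?\<Gamma> = h1 ` h2 ` ?\<Gamma>"
      unfolding image_image by (rule image_cong[OF HOL.refl])
    then have "compose \<aa> h1 h2 ` ?\<Gamma> \<subseteq> ?\<Gamma>" using \<Gamma> by blast
    moreover have "compose \<aa> h1 h2 \<in> orth_group B \<aa>"
      using o by (rule compose_orth_group)
    ultimately show ?case unfolding eq by simp
  qed
qed

text \<open>The shifted map sends \<open>x\<close> to \<open>y\<close> with
  \<open>y + \<delta> = w (x + \<delta>)\<close>, so the distance to \<open>- \<delta>\<close> is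
  kept. Since \<delta> belongs to the lattice, the translations before and after \<open>w\<close> do
  not leave it.\<close>

lemma tilde_preserves_sphere:
  assumes w: "w \<in> orth_group B \<aa>" "w ` \<Gamma>' \<subseteq> \<Gamma>'" and \<Gamma>': "\<Gamma>' = dual_lattice B \<aa> \<Gamma>" and \<delta>: "\<delta> \<in> \<Gamma>'"
  shows "tilde \<aa> \<delta> w ` (shifted_sphere B \<aa> (- \<delta>) a \<inter> \<Gamma>') \<subseteq> shifted_sphere B \<aa> (- \<delta>) a \<inter> \<Gamma>'"
proof
  fix y assume "y \<in> tilde \<aa> \<delta> w ` (shifted_sphere B \<aa> (- \<delta>) a \<inter> \<Gamma>')"
  then obtain x where x: "x \<in> \<aa>" "x \<in> \<Gamma>'" "sqrt (B (x + \<delta>) (x + \<delta>)) = a" and y: "y = w (x + \<delta>) - \<delta>"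
    by (auto simp: shifted_sphere_def tilde_def)
  have add: "u + v \<in> \<Gamma>'" "u - v \<in> \<Gamma>'" if "u \<in> \<Gamma>'" "v \<in> \<Gamma>'" for u v
    using that subspace_\<aa> unfolding \<Gamma>' dual_lattice_def
    by (auto simp: B_simps subspace_add subspace_diff)
  have "x + \<delta> \<in> \<Gamma>'" using add x(2) \<delta> by blast
  moreover from this have "y \<in> \<Gamma>'" unfolding y using w(2) add(2) \<delta> by blast
  ultimately show "y \<in> shifted_sphere B \<aa> (- \<delta>) a \<inter> \<Gamma>'"
    using x(3) orth_groupD(2)[OF w(1), of "x + \<delta>" "x + \<delta>"]
    by (auto simp: shifted_sphere_def y \<Gamma>' dual_lattice_def)
qed

end

theorem lemma4p4:
  fixes G :: "('g, 'e::euclidean_space) lie_group"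
    and K :: "'g set" and \<sigma> :: "'g \<Rightarrow> 'g"
    and B :: "'e \<Rightarrow> 'e \<Rightarrow> real"
    and \<aa> R C \<Gamma>' S :: "'e set" and \<delta> :: 'e
    and a l :: real
    and \<rho> :: "'g \<Rightarrow> complex^'m^'m"
  assumes "is_lie_group G"
    and "compact_space (topo G)"
    and "connected_space (topo G)"
    and "simple_lie_group G"
    and "symmetric_pair G K \<sigma>"
    and "Ad_invariant_inner_product G B"
    and "maximal_abelian_in G (p_space G \<sigma>) \<aa>"
    and "R = restricted_roots G B \<aa>"
    and "irreducible_roots B R"
    and "weyl_chamber B \<aa> R C"
    and "\<delta> = half_sum_positive G B \<aa> C"
    and "\<Gamma>' = dual_lattice B \<aa> (unit_lattice G \<aa>)"
    and "\<delta> \<in> \<Gamma>'"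
    and "a > 0"
    and "l = a\<^sup>2 - B \<delta> \<delta>"
    and "spherical_irrep G K \<rho>"
    and "casimir_eigenvalue G B \<rho> l"
    and "S = shifted_sphere B \<aa> (- \<delta>) a \<inter> \<Gamma>'"
  shows "tilde \<aa> \<delta> ` weyl_group B \<aa> R \<subseteq> orth_group_tilde_preserving B \<aa> \<delta> S"
proof -
  have "group G" using assms(1) by (simp add: is_lie_group_def)
  then interpret symmetric_setup G K \<sigma> B \<aa>
    using assms(1,5-7)
    by (simp add: symmetric_setup_def lie_grp_def lie_grp_axioms_def symmetric_setup_axioms_def)
  show ?thesis
  proof
    fix \<psi> assume "\<psi> \<in> tilde \<aa> \<delta> ` weyl_group B \<aa> R"
    then obtain w where w: "w \<in> weyl_group B \<aa> R" "\<psi> = tilde \<aa> \<delta> w" by blast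
    have "w \<in> orth_group B \<aa>" "w ` \<Gamma>' \<subseteq> \<Gamma>'"
      using weyl_group_invariance[OF assms(2)] w(1) unfolding assms(8,12) by auto
    then show "\<psi> \<in> orth_group_tilde_preserving B \<aa> \<delta> S"
      using tilde_preserves_sphere[OF _ _ assms(12,13)]
      unfolding orth_group_tilde_preserving_def orth_group_tilde_def w(2) assms(18) by blast
  qed
qed

end
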